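(* Let $\varphi$ be an s-Sahlqvist bimodal formula and let $f(\varphi)$ be its associated first-order formula (its classical Sahlqvist correspondent). Then for any subordination algebra $\underline{B}$ with dual $\underline{X}$, we have \[ \underline{B} \models \varphi \text{ if and only if } \underline{X} \models f(\varphi). \]
   Context: A subordination algebra is a pair $(B,\prec)$ with $B$ a Boolean algebra and $\prec$ a binary relation such that each $\prec(b,-)$ is a filter and each $\prec(-,b)$ is an ideal. Its dual is $\underline{X}=(X,R)$ with $X=\mathrm{Ult}(B)$ the Stone space of ultrafilters and $x \mathrel{R} y$ iff $\prec(y,-)\subseteq x$; $R$ is a closed relation. Bimodal formulas are built from variables, $\top,\bot$ with $\vee,\wedge,\neg$, the white diamond $\lozenge$ and the black diamond, written here $\lozenge^{-}$; $\square=\neg\lozenge\neg$ and $\square^{-}=\neg\lozenge^{-}\neg$. On subsets $E$ of $X$ (i.e. in the canonical extension $\mathcal{P}(X)$), $\lozenge E = R(-,E)$ and $\lozenge^{-} E = R(E,-)$. A valuation sends variables into $B$, viewed as clopen sets $r(b)=\{x\mid b\in x\}$, and is extended to all bimodal formulas in $\mathcal{P}(X)$; $\underline{B}\models\varphi$ means $\varphi$ evaluates to $X$ under every such valuation (equivalently, $(X,R)\models\varphi$ in Kripke semantics for all valuations into clopen sets). A formula is closed (resp. open) if obtained from $\top,\bot$, variables and their negations by $\vee,\wedge,\lozenge,\lozenge^{-}$ (resp. $\vee,\wedge,\square,\square^{-}$). It is positive (resp. negative) if obtained from $\top,\bot$ and variables (resp. negations of variables) by $\wedge,\vee,\lozenge,\square,\lozenge^{-},\square^{-}$.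 It is s-positive (resp. s-negative) if obtained from closed positive formulas (resp. open negative formulas) by $\vee,\wedge,\square,\square^{-}$ (resp. $\vee,\wedge,\lozenge,\lozenge^{-}$). A strongly positive formula is a conjunction of formulas $\square^{\langle\mu\rangle}p := \square^{\mu_1}(\square^{-})^{\mu_2}\cdots \square^{\mu_k}p$ with $p$ a variable, $\mu\in\mathbb{N}^k$. An s-untied formula is obtained from strongly positive and s-negative formulas using only $\wedge,\lozenge,\lozenge^{-}$. A formula is s-Sahlqvist if it has the form $\square^{\langle\mu\rangle}(\varphi_1\rightarrow\varphi_2)$ with $\varphi_1$ s-untied and $\varphi_2$ s-positive. Any s-Sahlqvist formula is a (bimodal) Sahlqvist formula, so by Sahlqvist's theorem there is a first-order formula $f(\varphi)$ in the language of one binary relation such that for any bimodal algebra with dual $\underline{X}$, the algebra validates $\varphi$ iff $\underline{X}\models f(\varphi)$. *)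

theory Defs
  imports Main
begin

section \<open>Bimodal formulas\<close>

datatype fm =
    Var nat
  | Verum
  | Falsum
  | Or fm fm
  | And fm fm
  | Neg fm
  | Dia fm
  | BDia fm

abbreviation Box :: "fm \<Rightarrow> fm" where
  "Box \<phi> \<equiv> Neg (Dia (Neg \<phi>))"

abbreviation BBox :: "fm \<Rightarrow> fm" where
  "BBox \<phi> \<equiv> Neg (BDia (Neg \<phi>))"

abbreviation Imp :: "fm \<Rightarrow> fm \<Rightarrow> fm" where
  "Imp \<phi> \<psi> \<equiv> Or (Neg \<phi>) \<psi>"

text \<open>The operation on subsets of \<open>X\<close> defined by a formula: \<open>Dia\<close> is the preimage and \<open>BDia\<close>
  the image under \<open>R\<close>.\<close>

fun eval :: "'w set \<Rightarrow> ('w \<Rightarrow> 'w \<Rightarrow> bool) \<Rightarrow> (nat \<Rightarrow> 'w set) \<Rightarrow> fm \<Rightarrow> 'w set" where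
  "eval X R V (Var p) = V p"
| "eval X R V Verum = X"
| "eval X R V Falsum = {}"
| "eval X R V (Or \<phi> \<psi>) = eval X R V \<phi> \<union> eval X R V \<psi>"
| "eval X R V (And \<phi> \<psi>) = eval X R V \<phi> \<inter> eval X R V \<psi>"
| "eval X R V (Neg \<phi>) = X - eval X R V \<phi>"
| "eval X R V (Dia \<phi>) = {x \<in> X. \<exists>y \<in> eval X R V \<phi>. R x y}"
| "eval X R V (BDia \<phi>) = {y \<in> X. \<exists>x \<in> eval X R V \<phi>. R x y}"


section \<open>Syntactic classes\<close>

inductive closed_fm :: "fm \<Rightarrow> bool" where
  "closed_fm Verum"
| "closed_fm Falsum"
| "closed_fm (Var p)"
| "closed_fm (Neg (Var p))"
| "closed_fm \<phi> \<Longrightarrow> closed_fm \<psi> \<Longrightarrow> closed_fm (Or \<phi> \<psi>)"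
| "closed_fm \<phi> \<Longrightarrow> closed_fm \<psi> \<Longrightarrow> closed_fm (And \<phi> \<psi>)"
| "closed_fm \<phi> \<Longrightarrow> closed_fm (Dia \<phi>)"
| "closed_fm \<phi> \<Longrightarrow> closed_fm (BDia \<phi>)"

inductive open_fm :: "fm \<Rightarrow> bool" where
  "open_fm Verum"
| "open_fm Falsum"
| "open_fm (Var p)"
| "open_fm (Neg (Var p))"
| "open_fm \<phi> \<Longrightarrow> open_fm \<psi> \<Longrightarrow> open_fm (Or \<phi> \<psi>)"
| "open_fm \<phi> \<Longrightarrow> open_fm \<psi> \<Longrightarrow> open_fm (And \<phi> \<psi>)"
| "open_fm \<phi> \<Longrightarrow> open_fm (Box \<phi>)"
| "open_fm \<phi> \<Longrightarrow> open_fm (BBox \<phi>)"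

inductive positive_fm :: "fm \<Rightarrow> bool" where
  "positive_fm Verum"
| "positive_fm Falsum"
| "positive_fm (Var p)"
| "positive_fm \<phi> \<Longrightarrow> positive_fm \<psi> \<Longrightarrow> positive_fm (And \<phi> \<psi>)"
| "positive_fm \<phi> \<Longrightarrow> positive_fm \<psi> \<Longrightarrow> positive_fm (Or \<phi> \<psi>)"
| "positive_fm \<phi> \<Longrightarrow> positive_fm (Dia \<phi>)"
| "positive_fm \<phi> \<Longrightarrow> positive_fm (Box \<phi>)"
| "positive_fm \<phi> \<Longrightarrow> positive_fm (BDia \<phi>)"
| "positive_fm \<phi> \<Longrightarrow> positive_fm (BBox \<phi>)"

inductive negative_fm :: "fm \<Rightarrow> bool" where
  "negative_fm Verum"
| "negative_fm Falsum"
| "negative_fm (Neg (Var p))"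
| "negative_fm \<phi> \<Longrightarrow> negative_fm \<psi> \<Longrightarrow> negative_fm (And \<phi> \<psi>)"
| "negative_fm \<phi> \<Longrightarrow> negative_fm \<psi> \<Longrightarrow> negative_fm (Or \<phi> \<psi>)"
| "negative_fm \<phi> \<Longrightarrow> negative_fm (Dia \<phi>)"
| "negative_fm \<phi> \<Longrightarrow> negative_fm (Box \<phi>)"
| "negative_fm \<phi> \<Longrightarrow> negative_fm (BDia \<phi>)"
| "negative_fm \<phi> \<Longrightarrow> negative_fm (BBox \<phi>)"

inductive s_positive :: "fm \<Rightarrow> bool" where
  "closed_fm \<phi> \<Longrightarrow> positive_fm \<phi> \<Longrightarrow> s_positive \<phi>"
| "s_positive \<phi> \<Longrightarrow> s_positive \<psi> \<Longrightarrow> s_positive (Or \<phi> \<psi>)"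
| "s_positive \<phi> \<Longrightarrow> s_positive \<psi> \<Longrightarrow> s_positive (And \<phi> \<psi>)"
| "s_positive \<phi> \<Longrightarrow> s_positive (Box \<phi>)"
| "s_positive \<phi> \<Longrightarrow> s_positive (BBox \<phi>)"

inductive s_negative :: "fm \<Rightarrow> bool" where
  "open_fm \<phi> \<Longrightarrow> negative_fm \<phi> \<Longrightarrow> s_negative \<phi>"
| "s_negative \<phi> \<Longrightarrow> s_negative \<psi> \<Longrightarrow> s_negative (Or \<phi> \<psi>)"
| "s_negative \<phi> \<Longrightarrow> s_negative \<psi> \<Longrightarrow> s_negative (And \<phi> \<psi>)"
| "s_negative \<phi> \<Longrightarrow> s_negative (Dia \<phi>)"
| "s_negative \<phi> \<Longrightarrow> s_negative (BDia \<phi>)"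

text \<open>\<open>boxes [m1, m2, m3, \<dots>] \<phi>\<close> prefixes \<open>\<phi>\<close> with \<open>m1\<close> white boxes, then \<open>m2\<close> black boxes, then \<open>m3\<close>
  white boxes, and so on. Exponents may be zero, so every word in the two boxes is of this form.\<close>

fun boxes :: "nat list \<Rightarrow> fm \<Rightarrow> fm" and bboxes :: "nat list \<Rightarrow> fm \<Rightarrow> fm" where
  "boxes [] \<phi> = \<phi>"
| "boxes (m # \<mu>) \<phi> = ((\<lambda>\<psi>. Box \<psi>) ^^ m) (bboxes \<mu> \<phi>)"
| "bboxes [] \<phi> = \<phi>"
| "bboxes (m # \<mu>) \<phi> = ((\<lambda>\<psi>. BBox \<psi>) ^^ m) (boxes \<mu> \<phi>)"

inductive strongly_positive :: "fm \<Rightarrow> bool" where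
  "strongly_positive (boxes \<mu> (Var p))"
| "strongly_positive \<phi> \<Longrightarrow> strongly_positive \<psi> \<Longrightarrow> strongly_positive (And \<phi> \<psi>)"

inductive s_untied :: "fm \<Rightarrow> bool" where
  "strongly_positive \<phi> \<Longrightarrow> s_untied \<phi>"
| "s_negative \<phi> \<Longrightarrow> s_untied \<phi>"
| "s_untied \<phi> \<Longrightarrow> s_untied \<psi> \<Longrightarrow> s_untied (And \<phi> \<psi>)"
| "s_untied \<phi> \<Longrightarrow> s_untied (Dia \<phi>)"
| "s_untied \<phi> \<Longrightarrow> s_untied (BDia \<phi>)"

definition s_sahlqvist :: "fm \<Rightarrow> bool" where
  "s_sahlqvist \<phi> \<longleftrightarrow>
    (\<exists>\<mu> \<phi>1 \<phi>2. \<phi> = boxes \<mu> (Imp \<phi>1 \<phi>2) \<and> s_untied \<phi>1 \<and> s_positive \<phi>2)"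


section \<open>First-order formulas over one binary relation\<close>

datatype fol =
    FBot
  | FEq nat nat
  | FRel nat nat
  | FNeg fol
  | FConj fol fol
  | FDisj fol fol
  | FImp fol fol
  | FAll nat fol
  | FEx nat fol

fun holds :: "'w set \<Rightarrow> ('w \<Rightarrow> 'w \<Rightarrow> bool) \<Rightarrow> (nat \<Rightarrow> 'w) \<Rightarrow> fol \<Rightarrow> bool" where
  "holds X R e FBot \<longleftrightarrow> False"
| "holds X R e (FEq i j) \<longleftrightarrow> e i = e j"
| "holds X R e (FRel i j) \<longleftrightarrow> R (e i) (e j)"
| "holds X R e (FNeg \<alpha>) \<longleftrightarrow> \<not> holds X R e \<alpha>"
| "holds X R e (FConj \<alpha> \<beta>) \<longleftrightarrow> holds X R e \<alpha> \<and> holds X R e \<beta>"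
| "holds X R e (FDisj \<alpha> \<beta>) \<longleftrightarrow> holds X R e \<alpha> \<or> holds X R e \<beta>"
| "holds X R e (FImp \<alpha> \<beta>) \<longleftrightarrow> (holds X R e \<alpha> \<longrightarrow> holds X R e \<beta>)"
| "holds X R e (FAll i \<alpha>) \<longleftrightarrow> (\<forall>x \<in> X. holds X R (e(i := x)) \<alpha>)"
| "holds X R e (FEx i \<alpha>) \<longleftrightarrow> (\<exists>x \<in> X. holds X R (e(i := x)) \<alpha>)"

text \<open>Only applied to sentences, for which the choice of \<open>e\<close> is irrelevant. Assignments are not required to take
  values in \<open>X\<close>, so that the definition is also right for the empty structure (the dual of the
  one-element Boolean algebra).\<close>

definition models :: "'w set \<Rightarrow> ('w \<Rightarrow> 'w \<Rightarrow> bool) \<Rightarrow> fol \<Rightarrow> bool" where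
  "models X R \<alpha> \<longleftrightarrow> (\<forall>e. holds X R e \<alpha>)"


section \<open>The Sahlqvist correspondent\<close>

text \<open>The Sahlqvist--van Benthem algorithm. Throughout, \<open>n\<close> is a first-order variable such that all
  variables \<open>\<ge> n\<close> are fresh.\<close>

datatype colour = White | Black

fun edge :: "colour \<Rightarrow> nat \<Rightarrow> nat \<Rightarrow> fol" where
  "edge White i j = FRel i j"
| "edge Black i j = FRel j i"

text \<open>\<open>path cs i j n\<close>: \<open>j\<close> is reachable from \<open>i\<close> by successive steps of the colours \<open>cs\<close>; that is,
  \<open>j\<close> lies in the least value of \<open>p\<close> which makes the corresponding boxed atom over \<open>p\<close> true at \<open>i\<close>.\<close>

fun path :: "colour list \<Rightarrow> nat \<Rightarrow> nat \<Rightarrow> nat \<Rightarrow> fol" where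
  "path [] i j n = FEq i j"
| "path (c # cs) i j n = FEx n (FConj (edge c i n) (path cs n j (Suc n)))"

text \<open>An entry \<open>(p, cs, i)\<close> of \<open>A\<close> says that the boxed atom over \<open>p\<close> with prefix \<open>cs\<close> occurs at \<open>i\<close>.
  \<open>minval A p j n\<close> expresses that \<open>j\<close> belongs to the minimal value of \<open>p\<close>, which is empty if
  \<open>p\<close> does not occur in \<open>A\<close>.\<close>

fun minval :: "(nat \<times> colour list \<times> nat) list \<Rightarrow> nat \<Rightarrow> nat \<Rightarrow> nat \<Rightarrow> fol" where
  "minval [] p j n = FBot"
| "minval ((q, cs, i) # A) p j n =
    (if q = p then FDisj (path cs i j n) (minval A p j n) else minval A p j n)"

text \<open>The standard translation at \<open>i\<close>, with the minimal valuation substituted for the unary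
  predicates.\<close>

fun st :: "(nat \<times> colour list \<times> nat) list \<Rightarrow> nat \<Rightarrow> nat \<Rightarrow> fm \<Rightarrow> fol" where
  "st A i n (Var p) = minval A p i n"
| "st A i n Verum = FNeg FBot"
| "st A i n Falsum = FBot"
| "st A i n (Or \<phi> \<psi>) = FDisj (st A i n \<phi>) (st A i n \<psi>)"
| "st A i n (And \<phi> \<psi>) = FConj (st A i n \<phi>) (st A i n \<psi>)"
| "st A i n (Neg \<phi>) = FNeg (st A i n \<phi>)"
| "st A i n (Dia \<phi>) = FEx n (FConj (FRel i n) (st A n (Suc n) \<phi>))"
| "st A i n (BDia \<phi>) = FEx n (FConj (FRel n i) (st A n (Suc n) \<phi>))"

fun boxed_atom :: "fm \<Rightarrow> (nat \<times> colour list) option" where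
  "boxed_atom (Var p) = Some (p, [])"
| "boxed_atom (Box \<phi>) = map_option (\<lambda>(p, cs). (p, White # cs)) (boxed_atom \<phi>)"
| "boxed_atom (BBox \<phi>) = map_option (\<lambda>(p, cs). (p, Black # cs)) (boxed_atom \<phi>)"
| "boxed_atom _ = None"

text \<open>\<open>decompose i n \<phi> = (m, D, A, N)\<close> decomposes the antecedent \<open>\<phi>\<close> at \<open>i\<close>: the variables \<open>n..<m\<close> are
  the worlds introduced by its diamonds, \<open>D\<close> lists the edges leading to them, \<open>A\<close> the boxed atoms and \<open>N\<close>
  the negative parts, both together with the world at which they are asserted.\<close>

fun decompose :: "nat \<Rightarrow> nat \<Rightarrow> fm \<Rightarrow>
    nat \<times> fol list \<times> (nat \<times> colour list \<times> nat) list \<times> (fm \<times> nat) list" where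
  "decompose i n (And \<phi> \<psi>) =
    (let (n1, D1, A1, N1) = decompose i n \<phi>; (n2, D2, A2, N2) = decompose i n1 \<psi>
     in (n2, D1 @ D2, A1 @ A2, N1 @ N2))"
| "decompose i n (Dia \<phi>) =
    (let (m, D, A, N) = decompose n (Suc n) \<phi> in (m, FRel i n # D, A, N))"
| "decompose i n (BDia \<phi>) =
    (let (m, D, A, N) = decompose n (Suc n) \<phi> in (m, FRel n i # D, A, N))"
| "decompose i n \<phi> =
    (case boxed_atom \<phi> of
       Some (p, cs) \<Rightarrow> (n, [], [(p, cs, i)], [])
     | None \<Rightarrow> (n, [], [], [(\<phi>, i)]))"

fun corr_at :: "nat \<Rightarrow> nat \<Rightarrow> fm \<Rightarrow> fol" where
  "corr_at i n (Box \<phi>) = FAll n (FImp (FRel i n) (corr_at n (Suc n) \<phi>))"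
| "corr_at i n (BBox \<phi>) = FAll n (FImp (FRel n i) (corr_at n (Suc n) \<phi>))"
| "corr_at i n (Imp \<phi>1 \<phi>2) =
    (let (m, D, A, N) = decompose i n \<phi>1
     in foldr FAll [n..<m]
          (foldr FImp (D @ map (\<lambda>(\<psi>, j). st A j m \<psi>) N) (st A i m \<phi>2)))"
| "corr_at _ _ _ = FBot"  \<comment> \<open>not reached from \<open>s_sahlqvist\<close> formulas\<close>

definition sahlqvist_correspondent :: "fm \<Rightarrow> fol" where
  "sahlqvist_correspondent \<phi> = FAll 0 (corr_at 0 1 \<phi>)"


section \<open>Subordination algebras and their duals\<close>

definition is_filter :: "'a::boolean_algebra set \<Rightarrow> bool" where
  "is_filter F \<longleftrightarrow> top \<in> F \<and> (\<forall>a \<in> F. \<forall>b \<in> F. inf a b \<in> F) \<and> (\<forall>a \<in> F. \<forall>b. a \<le> b \<longrightarrow> b \<in> F)"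

definition is_ideal :: "'a::boolean_algebra set \<Rightarrow> bool" where
  "is_ideal I \<longleftrightarrow> bot \<in> I \<and> (\<forall>a \<in> I. \<forall>b \<in> I. sup a b \<in> I) \<and> (\<forall>a \<in> I. \<forall>b. b \<le> a \<longrightarrow> b \<in> I)"

definition is_ultrafilter :: "'a::boolean_algebra set \<Rightarrow> bool" where
  "is_ultrafilter U \<longleftrightarrow> is_filter U \<and> bot \<notin> U \<and> (\<forall>a. a \<in> U \<or> - a \<in> U)"

locale subordination_algebra =
  fixes prec :: "'a::boolean_algebra \<Rightarrow> 'a \<Rightarrow> bool"
  assumes filter_above: "is_filter {c. prec b c}"
    and ideal_below: "is_ideal {a. prec a b}"

definition Ult :: "'a::boolean_algebra set set" where
  "Ult = {U. is_ultrafilter U}"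

definition dual_rel :: "('a::boolean_algebra \<Rightarrow> 'a \<Rightarrow> bool) \<Rightarrow> 'a set \<Rightarrow> 'a set \<Rightarrow> bool" where
  "dual_rel prec x y \<longleftrightarrow> {c. \<exists>b \<in> y. prec b c} \<subseteq> x"

definition stone :: "'a::boolean_algebra \<Rightarrow> 'a set set" where
  "stone b = {x \<in> Ult. b \<in> x}"

text \<open>The sets \<open>stone b\<close> are exactly the clopen subsets of the Stone space \<open>Ult\<close>, so the topology need not
  be mentioned. \<open>{b. prec a b}\<close> is the set written \<open>\<prec>(a,-)\<close>, and \<open>\<prec>(y,-)\<close> for a set \<open>y\<close> is
  the union of these over \<open>a \<in> y\<close>.\<close>

definition validates :: "('a::boolean_algebra \<Rightarrow> 'a \<Rightarrow> bool) \<Rightarrow> fm \<Rightarrow> bool" where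
  "validates prec \<phi> \<longleftrightarrow>
    (\<forall>v :: nat \<Rightarrow> 'a. eval Ult (dual_rel prec) (\<lambda>p. stone (v p)) \<phi> = Ult)"


section \<open>Adequacy of the correspondent\<close>

text \<open>This section proves \<open>classical_correspondence\<close>: on every Kripke frame, \<open>sahlqvist_correspondent \<phi>\<close>
  holds iff \<open>\<phi>\<close> is true under all valuations into arbitrary subsets.\<close>

fun colour_step where "colour_step R White u v = R u v" | "colour_step R Black u v = R v u"
fun colour_reach where
  "colour_reach X R [] u v = (u = v)"
| "colour_reach X R (c # cs) u v = (\<exists>z\<in>X. colour_step R c u z \<and> colour_reach X R cs z v)"

lemma holds_edge: "holds X R e (edge c i j) \<longleftrightarrow> colour_step R c (e i) (e j)"
  by (cases c) auto

lemma holds_path: "i < n \<Longrightarrow> j < n \<Longrightarrow> holds X R e (path cs i j n) \<longleftrightarrow> colour_reach X R cs (e i) (e j)"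
  by (induction cs i j n arbitrary: e rule: path.induct) (auto simp: holds_edge)

definition min_valuation where "min_valuation X R e A p = {v\<in>X. \<exists>(q,cs,i)\<in>set A. q = p \<and> colour_reach X R cs (e i) v}"

lemma holds_minval: "\<forall>(q,cs,i)\<in>set A. i < n \<Longrightarrow> j < n \<Longrightarrow>
  holds X R e (minval A p j n) \<longleftrightarrow> (\<exists>(q,cs,i)\<in>set A. q = p \<and> colour_reach X R cs (e i) (e j))"
  by (induction A p j n rule: minval.induct) (auto simp: holds_path)

lemma min_valuation_cong: "\<forall>(q,cs,i)\<in>set A. e i = e' i \<Longrightarrow> min_valuation X R e A = min_valuation X R e' A"
proof (rule ext)
  fix p assume h: "\<forall>(q,cs,i)\<in>set A. e i = e' i"
  have "(\<exists>(q,cs,i)\<in>set A. q = p \<and> colour_reach X R cs (e i) v) = (\<exists>(q,cs,i)\<in>set A. q = p \<and> colour_reach X R cs (e' i) v)" for v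
    by (rule bex_cong[OF refl]) (use h in auto)
  then show "min_valuation X R e A p = min_valuation X R e' A p" unfolding min_valuation_def by simp
qed

lemma eval_subset: "(\<And>p. V p \<subseteq> X) \<Longrightarrow> eval X R V \<phi> \<subseteq> X"
  by (induction \<phi>) auto

lemma holds_st: "i < n \<Longrightarrow> \<forall>(q,cs,i)\<in>set A. i < n \<Longrightarrow> e i \<in> X \<Longrightarrow>
  holds X R e (st A i n \<phi>) \<longleftrightarrow> e i \<in> eval X R (min_valuation X R e A) \<phi>"
proof (induction \<phi> arbitrary: i n e)
  case (Dia \<phi>)
  have *: "min_valuation X R (e(n:=z)) A = min_valuation X R e A" for z using Dia.prems by (intro min_valuation_cong) auto
  have "eval X R (min_valuation X R e A) \<phi> \<subseteq> X" by (rule eval_subset) (auto simp: min_valuation_def)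
  moreover have "holds X R (e(n:=z)) (st A n (Suc n) \<phi>) \<longleftrightarrow> z \<in> eval X R (min_valuation X R e A) \<phi>" if "z\<in>X" for z
    using Dia.IH[of n "Suc n" "e(n:=z)"] that Dia.prems * by fastforce
  ultimately show ?case using Dia.prems by auto
next
  case (BDia \<phi>)
  have *: "min_valuation X R (e(n:=z)) A = min_valuation X R e A" for z using BDia.prems by (intro min_valuation_cong) auto
  have "eval X R (min_valuation X R e A) \<phi> \<subseteq> X" by (rule eval_subset) (auto simp: min_valuation_def)
  moreover have "holds X R (e(n:=z)) (st A n (Suc n) \<phi>) \<longleftrightarrow> z \<in> eval X R (min_valuation X R e A) \<phi>" if "z\<in>X" for z
    using BDia.IH[of n "Suc n" "e(n:=z)"] that BDia.prems * by fastforce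
  ultimately show ?case using BDia.prems by auto
next
  case (Var p) then show ?case by (auto simp: holds_minval min_valuation_def)
qed auto

lemma boxed_atom_eval: "boxed_atom \<phi> = Some (p,cs) \<Longrightarrow> (\<And>p. V p \<subseteq> X) \<Longrightarrow> x \<in> X \<Longrightarrow>
  x \<in> eval X R V \<phi> \<longleftrightarrow> (\<forall>v\<in>X. colour_reach X R cs x v \<longrightarrow> v \<in> V p)"
  by (induction \<phi> arbitrary: cs x rule: boxed_atom.induct) (auto, blast+)

definition agree_outside where "agree_outside X e e' n m \<longleftrightarrow> (\<forall>i::nat. (i \<in> {n..<m} \<longrightarrow> e' i \<in> X) \<and> (i \<notin> {n..<m} \<longrightarrow> e' i = e i))"

definition decomposition_true where "decomposition_true X R V e D A N \<longleftrightarrow> (\<forall>d\<in>set D. holds X R e d) \<and>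
  (\<forall>(p,cs,i)\<in>set A. \<forall>v\<in>X. colour_reach X R cs (e i) v \<longrightarrow> v \<in> V p) \<and> (\<forall>(\<psi>,i)\<in>set N. e i \<in> eval X R V \<psi>)"

definition vars_below where "vars_below m D A N \<longleftrightarrow> (\<forall>d\<in>set D. \<exists>i j. d = FRel i j \<and> i < m \<and> j < m) \<and>
  (\<forall>(p,cs,i)\<in>set A. i < m) \<and> (\<forall>(\<psi>,i)\<in>set N. i < (m::nat))"

lemma decomposition_true_cong: "vars_below m D A N \<Longrightarrow> (\<And>i. i < m \<Longrightarrow> e i = e' i) \<Longrightarrow> decomposition_true X R V e D A N = decomposition_true X R V e' D A N"
  unfolding vars_below_def decomposition_true_def
  apply (intro conj_cong ball_cong refl)
  by fastforce+

lemma vars_below_mono: "vars_below m D A N \<Longrightarrow> m \<le> m' \<Longrightarrow> vars_below m' D A N"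
  unfolding vars_below_def by fastforce

lemma decompose_leaf: assumes "(case boxed_atom \<phi> of Some (p, cs) \<Rightarrow> (n, [], [(p, cs, i)], []) | None \<Rightarrow> (n, [], [], [(\<phi>, i)])) = (m,D,A,N)"
   and "i < (n::nat)" "e i \<in> X" "\<And>p. V p \<subseteq> X"
 shows "n \<le> m \<and> vars_below m D A N \<and> (e i \<in> eval X R V \<phi> \<longleftrightarrow> (\<exists>e'. agree_outside X e e' n m \<and> decomposition_true X R V e' D A N))"
proof -
  have ag: "agree_outside X e e' k k \<longleftrightarrow> e' = e" for e' k unfolding agree_outside_def fun_eq_iff atLeastLessThan_iff by (meson leD)
  show ?thesis
  proof (cases "boxed_atom \<phi>")
    case None then show ?thesis using assms by (auto simp: vars_below_def decomposition_true_def ag)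
  next
    case (Some a) obtain p cs where a: "a = (p,cs)" by force
    show ?thesis using assms Some a boxed_atom_eval[of \<phi> p cs V X "e i"]
      by (auto simp: vars_below_def decomposition_true_def ag)
  qed
qed

lemma decompose_leaf_all: assumes eq: "decompose i n \<phi> = (case boxed_atom \<phi> of Some (p, cs) \<Rightarrow> (n, [], [(p, cs, i)], []) | None \<Rightarrow> (n, [], [], [(\<phi>, i)]))"
   and d: "decompose i n \<phi> = (m,D,A,N)" and i: "i < n" and V: "\<And>p. V p \<subseteq> X" and e0: "X \<noteq> {}"
 shows "n \<le> m \<and> vars_below m D A N \<and> (\<forall>e. e i \<in> X \<longrightarrow> (e i \<in> eval X R V \<phi> \<longleftrightarrow> (\<exists>e'. agree_outside X e e' n m \<and> decomposition_true X R V e' D A N)))"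
proof -
  obtain x where x: "x \<in> X" using e0 by blast
  have l: "n \<le> m \<and> vars_below m D A N \<and> (e i \<in> eval X R V \<phi> \<longleftrightarrow> (\<exists>e'. agree_outside X e e' n m \<and> decomposition_true X R V e' D A N))" if "e i \<in> X" for e
    by (rule decompose_leaf[OF trans[OF eq[symmetric] d] i]) (use that V in auto)
  show ?thesis using l[of "\<lambda>_. x"] l x by blast
qed

lemma decompose_correct:
  assumes V: "\<And>p. V p \<subseteq> X" and e0: "X \<noteq> {}"
  shows "decompose i n \<phi> = (m,D,A,N) \<Longrightarrow> i < n \<Longrightarrow>
   n \<le> m \<and> vars_below m D A N \<and> (\<forall>e. e i \<in> X \<longrightarrow> (e i \<in> eval X R V \<phi> \<longleftrightarrow> (\<exists>e'. agree_outside X e e' n m \<and> decomposition_true X R V e' D A N)))"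
proof (induction i n \<phi> arbitrary: m D A N rule: decompose.induct)
  case (1 i n \<phi> \<psi>)
  obtain n1 D1 A1 N1 where d1: "decompose i n \<phi> = (n1,D1,A1,N1)" by (metis surj_pair)
  obtain n2 D2 A2 N2 where d2: "decompose i n1 \<psi> = (n2,D2,A2,N2)" by (metis surj_pair)
  have eqs: "m = n2" "D = D1@D2" "A = A1@A2" "N = N1@N2" using "1.prems" d1 d2 by auto
  note I1 = "1.IH"(1)[OF d1 "1.prems"(2)]
  have "i < n1" using I1 "1.prems" by auto
  note I2 = "1.IH"(2)[OF d1[symmetric] refl refl refl d2 this]
  have "vars_below m D A N" using I1 I2 vars_below_mono[of n1 D1 A1 N1 n2] by (auto simp: vars_below_def eqs)
  moreover have "e i \<in> eval X R V (And \<phi> \<psi>) \<longleftrightarrow> (\<exists>e'. agree_outside X e e' n m \<and> decomposition_true X R V e' D A N)" (is "?L = ?R") if e: "e i \<in> X" for e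
  proof
    assume ?L
    then obtain e1 where e1: "agree_outside X e e1 n n1" "decomposition_true X R V e1 D1 A1 N1" using I1 e by auto
    have ee: "e1 i = e i" using e1(1) "1.prems" by (auto simp: agree_outside_def)
    have "e1 i \<in> X" "e1 i \<in> eval X R V \<psi>" using ee e \<open>?L\<close> by auto
    with I2[THEN conjunct2, THEN conjunct2, rule_format, of e1]
    obtain e2 where e2: "agree_outside X e1 e2 n1 n2" "decomposition_true X R V e2 D2 A2 N2" by blast
    have "decomposition_true X R V e2 D1 A1 N1" using e1(2) decomposition_true_cong[of n1 D1 A1 N1 e1 e2] I1 e2(1) by (auto simp: agree_outside_def)
    then have "decomposition_true X R V e2 D A N" using e2 by (auto simp: decomposition_true_def eqs)
    moreover have "agree_outside X e e2 n m" using e1(1) e2(1) I1 I2 unfolding agree_outside_def eqs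
      by (metis atLeastLessThan_iff le_less_trans not_le order_less_le_trans le_trans)
    ultimately show ?R by blast
  next
    assume ?R
    then obtain e2 where e2: "agree_outside X e e2 n m" "decomposition_true X R V e2 D A N" by blast
    define e1 where "e1 k = (if k < n1 then e2 k else e k)" for k
    have ag1: "agree_outside X e e1 n n1" using e2(1) I1 I2 unfolding agree_outside_def e1_def eqs by auto
    have ag2: "agree_outside X e1 e2 n1 n2" using e2(1) I1 I2 unfolding agree_outside_def e1_def eqs by auto
    have "decomposition_true X R V e2 D1 A1 N1" using e2(2) by (auto simp: decomposition_true_def eqs)
    then have "decomposition_true X R V e1 D1 A1 N1" using decomposition_true_cong[of n1 D1 A1 N1 e1 e2] I1 by (auto simp: e1_def)
    then have a: "e i \<in> eval X R V \<phi>" using I1 e ag1 by blast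
    have ee: "e1 i = e i" using ag1 "1.prems" by (auto simp: agree_outside_def)
    have "decomposition_true X R V e2 D2 A2 N2" using e2(2) by (auto simp: decomposition_true_def eqs)
    then have "e i \<in> eval X R V \<psi>" using I2 e ag2 ee by metis
    with a show ?L by simp
  qed
  ultimately show ?case using I1 I2 eqs by auto
next
  case (2 i n \<phi>)
  obtain D' where d: "decompose n (Suc n) \<phi> = (m,D',A,N)" and D: "D = FRel i n # D'"
    using "2.prems" by (auto split: prod.splits)
  note I = "2.IH"[OF d]
  have ag: "(\<exists>z\<in>X. R (e i) z \<and> (\<exists>e'. agree_outside X (e(n:=z)) e' (Suc n) m \<and> decomposition_true X R V e' D' A N)) \<longleftrightarrow>
     (\<exists>e'. agree_outside X e e' n m \<and> decomposition_true X R V e' D A N)" (is "?L = ?R") for e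
  proof
    assume ?L
    then obtain z e' where z: "z\<in>X" "R (e i) z" "agree_outside X (e(n:=z)) e' (Suc n) m" "decomposition_true X R V e' D' A N" by blast
    then have "e' n = z" "e' i = e i" using "2.prems" by (auto simp: agree_outside_def)
    with z(4) z(2) have "decomposition_true X R V e' D A N" by (auto simp: decomposition_true_def D)
    moreover have "agree_outside X e e' n m" unfolding agree_outside_def
    proof
      fix k show "(k \<in> {n..<m} \<longrightarrow> e' k \<in> X) \<and> (k \<notin> {n..<m} \<longrightarrow> e' k = e k)"
        using z(1,3) \<open>e' n = z\<close> I unfolding agree_outside_def by (cases "k = n") (auto dest!: spec[of _ k])
    qed
    ultimately show ?R by blast
  next
    assume ?R
    then obtain e' where e': "agree_outside X e e' n m" "decomposition_true X R V e' D A N" by blast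
    then have "e' i = e i" using "2.prems" by (auto simp: agree_outside_def)
    have "e' n \<in> X" using e' I by (auto simp: agree_outside_def)
    moreover have "agree_outside X (e(n := e' n)) e' (Suc n) m" using e' by (auto simp: agree_outside_def)
    moreover have "R (e i) (e' n)" "decomposition_true X R V e' D' A N" using e' \<open>e' i = e i\<close> by (auto simp: decomposition_true_def D)
    ultimately show ?L by blast
  qed
  have "vars_below m D A N" using I "2.prems" by (auto simp: vars_below_def D)
  moreover have "e i \<in> eval X R V (Dia \<phi>) \<longleftrightarrow> (\<exists>z\<in>X. R (e i) z \<and> (\<exists>e'. agree_outside X (e(n:=z)) e' (Suc n) m \<and> decomposition_true X R V e' D' A N))" if "e i \<in> X" for e
  proof -
    have "(z \<in> eval X R V \<phi>) \<longleftrightarrow> (\<exists>e'. agree_outside X (e(n:=z)) e' (Suc n) m \<and> decomposition_true X R V e' D' A N)" if "z \<in> X" for z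
      using I[THEN conjunct2, THEN conjunct2, rule_format, of "e(n:=z)"] that by simp
    moreover have "e i \<in> eval X R V (Dia \<phi>) \<longleftrightarrow> (\<exists>z\<in>X. R (e i) z \<and> z \<in> eval X R V \<phi>)"
      using that eval_subset[of V X R \<phi>, OF V] by auto
    ultimately show ?thesis by (simp del: eval.simps)
  qed
  ultimately show ?case using I ag by auto
next
  case (3 i n \<phi>)
  obtain D' where d: "decompose n (Suc n) \<phi> = (m,D',A,N)" and D: "D = FRel n i # D'"
    using "3.prems" by (auto split: prod.splits)
  note I = "3.IH"[OF d]
  have ag: "(\<exists>z\<in>X. R z (e i) \<and> (\<exists>e'. agree_outside X (e(n:=z)) e' (Suc n) m \<and> decomposition_true X R V e' D' A N)) \<longleftrightarrow>
     (\<exists>e'. agree_outside X e e' n m \<and> decomposition_true X R V e' D A N)" (is "?L = ?R") for e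
  proof
    assume ?L
    then obtain z e' where z: "z\<in>X" "R z (e i)" "agree_outside X (e(n:=z)) e' (Suc n) m" "decomposition_true X R V e' D' A N" by blast
    then have "e' n = z" "e' i = e i" using "3.prems" by (auto simp: agree_outside_def)
    with z(4) z(2) have "decomposition_true X R V e' D A N" by (auto simp: decomposition_true_def D)
    moreover have "agree_outside X e e' n m" unfolding agree_outside_def
    proof
      fix k show "(k \<in> {n..<m} \<longrightarrow> e' k \<in> X) \<and> (k \<notin> {n..<m} \<longrightarrow> e' k = e k)"
        using z(1,3) \<open>e' n = z\<close> I unfolding agree_outside_def by (cases "k = n") (auto dest!: spec[of _ k])
    qed
    ultimately show ?R by blast
  next
    assume ?R
    then obtain e' where e': "agree_outside X e e' n m" "decomposition_true X R V e' D A N" by blast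
    then have "e' i = e i" using "3.prems" by (auto simp: agree_outside_def)
    have "e' n \<in> X" using e' I by (auto simp: agree_outside_def)
    moreover have "agree_outside X (e(n := e' n)) e' (Suc n) m" using e' by (auto simp: agree_outside_def)
    moreover have "R (e' n) (e i)" "decomposition_true X R V e' D' A N" using e' \<open>e' i = e i\<close> by (auto simp: decomposition_true_def D)
    ultimately show ?L by blast
  qed
  have "vars_below m D A N" using I "3.prems" by (auto simp: vars_below_def D)
  moreover have "e i \<in> eval X R V (BDia \<phi>) \<longleftrightarrow> (\<exists>z\<in>X. R z (e i) \<and> (\<exists>e'. agree_outside X (e(n:=z)) e' (Suc n) m \<and> decomposition_true X R V e' D' A N))" if "e i \<in> X" for e
  proof -
    have "(z \<in> eval X R V \<phi>) \<longleftrightarrow> (\<exists>e'. agree_outside X (e(n:=z)) e' (Suc n) m \<and> decomposition_true X R V e' D' A N)" if "z \<in> X" for z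
      using I[THEN conjunct2, THEN conjunct2, rule_format, of "e(n:=z)"] that by simp
    moreover have "e i \<in> eval X R V (BDia \<phi>) \<longleftrightarrow> (\<exists>z\<in>X. R z (e i) \<and> z \<in> eval X R V \<phi>)"
      using that eval_subset[of V X R \<phi>, OF V] by auto
    ultimately show ?thesis by (simp del: eval.simps)
  qed
  ultimately show ?case using I ag by auto
qed ((rule decompose_leaf_all[OF _ _ _ V e0], simp, assumption, assumption)+)

lemma eval_mono_positive: assumes "positive_fm \<phi>" and V: "\<And>p. V p \<subseteq> W p" shows "eval X R V \<phi> \<subseteq> eval X R W \<phi>"
  using assms(1) by induction (use V in \<open>simp; blast\<close>)+
lemma eval_antimono_negative: assumes "negative_fm \<phi>" and V: "\<And>p. V p \<subseteq> W p" shows "eval X R W \<phi> \<subseteq> eval X R V \<phi>"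
  using assms(1) by induction (use V in \<open>simp; blast\<close>)+
lemma s_positive_imp_positive: "s_positive \<phi> \<Longrightarrow> positive_fm \<phi>"
  by (induction rule: s_positive.induct) (auto intro: positive_fm.intros)
lemma s_negative_imp_negative: "s_negative \<phi> \<Longrightarrow> negative_fm \<phi>"
  by (induction rule: s_negative.induct) (auto intro: negative_fm.intros)

lemma boxed_atom_power: "(\<exists>p cs. boxed_atom \<phi> = Some (p,cs)) \<Longrightarrow> (\<exists>p cs. boxed_atom (((\<lambda>\<psi>. Box \<psi>) ^^ m) \<phi>) = Some (p,cs))"
  by (induction m) auto
lemma boxed_atom_power_black: "(\<exists>p cs. boxed_atom \<phi> = Some (p,cs)) \<Longrightarrow> (\<exists>p cs. boxed_atom (((\<lambda>\<psi>. BBox \<psi>) ^^ m) \<phi>) = Some (p,cs))"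
  by (induction m) auto
lemma boxed_atom_boxes: "(\<exists>p cs. boxed_atom \<phi> = Some (p,cs)) \<Longrightarrow> \<exists>p cs. boxed_atom (boxes \<mu> \<phi>) = Some (p,cs)"
   "(\<exists>p cs. boxed_atom \<phi> = Some (p,cs)) \<Longrightarrow> \<exists>p cs. boxed_atom (bboxes \<mu> \<phi>) = Some (p,cs)"
  by (induction \<mu> \<phi> and \<mu> \<phi> rule: boxes_bboxes.induct) (simp_all add: boxed_atom_power boxed_atom_power_black)

lemma strongly_positive_shape: "strongly_positive \<phi> \<Longrightarrow> (\<exists>a b. \<phi> = And a b \<and> strongly_positive a \<and> strongly_positive b) \<or> boxed_atom \<phi> \<noteq> None"
proof (induction rule: strongly_positive.induct)
  case (1 \<mu> p) then show ?case using boxed_atom_boxes(1)[of "Var p" \<mu>] by auto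
qed auto

lemma decompose_negs: "s_untied \<phi> \<or> strongly_positive \<phi> \<or> negative_fm \<phi> \<Longrightarrow> decompose i n \<phi> = (m,D,A,N) \<Longrightarrow> \<forall>(\<psi>,j)\<in>set N. negative_fm \<psi>"
proof (induction i n \<phi> arbitrary: m D A N rule: decompose.induct)
  case (1 i n \<phi> \<psi>)
  have b: "boxed_atom (And \<phi> \<psi>) = None" by simp
  have s: "(strongly_positive \<phi> \<and> strongly_positive \<psi>)" if "strongly_positive (And \<phi> \<psi>)"
    using strongly_positive_shape[OF that] b by auto
  have ng: "negative_fm \<phi> \<and> negative_fm \<psi>" if "negative_fm (And \<phi> \<psi>)"
    using that by (cases rule: negative_fm.cases) auto
  have "(s_untied \<phi> \<or> strongly_positive \<phi> \<or> negative_fm \<phi>) \<and> (s_untied \<psi> \<or> strongly_positive \<psi> \<or> negative_fm \<psi>)"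
    using "1.prems"(1)
    apply (elim disjE)
    subgoal by (erule s_untied.cases) (use s ng s_negative_imp_negative in \<open>auto\<close>)
    using s ng by auto
  then show ?case using 1 by (fastforce split: prod.splits)
next
  case (2 i n \<phi>)
  have b: "boxed_atom (Dia \<phi>) = None" by simp
  have s: "\<not> strongly_positive (Dia \<phi>)"
    using b strongly_positive_shape by fastforce
  have ng: "negative_fm \<phi>" if "negative_fm (Dia \<phi>)"
    using that by (cases rule: negative_fm.cases) auto
  have "(s_untied \<phi> \<or> strongly_positive \<phi> \<or> negative_fm \<phi>)"
    using "2.prems"(1)
    apply (elim disjE)
    subgoal by (erule s_untied.cases) (use s ng s_negative_imp_negative in \<open>auto\<close>)
    using s ng by auto
  then show ?case using 2 by (fastforce split: prod.splits)
next
  case (3 i n \<phi>)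
  have b: "boxed_atom (BDia \<phi>) = None" by simp
  have s: "\<not> strongly_positive (BDia \<phi>)"
    using b strongly_positive_shape by fastforce
  have ng: "negative_fm \<phi>" if "negative_fm (BDia \<phi>)"
    using that by (cases rule: negative_fm.cases) auto
  have "(s_untied \<phi> \<or> strongly_positive \<phi> \<or> negative_fm \<phi>)"
    using "3.prems"(1)
    apply (elim disjE)
    subgoal by (erule s_untied.cases) (use s ng s_negative_imp_negative in \<open>auto\<close>)
    using s ng by auto
  then show ?case using 3 by (fastforce split: prod.splits)
next
  case ("4_1" i n v) then show ?case by auto
next
  case ("4_2" i n) then show ?case by (auto intro: negative_fm.intros)
next
  case ("4_3" i n) then show ?case by (auto intro: negative_fm.intros)
next
  case ("4_4" i n v va)
  let ?f = "Or v va"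
  have "boxed_atom ?f = None" by simp
  then have s: "\<not> strongly_positive ?f"
    using strongly_positive_shape by fastforce
  have "negative_fm ?f" using "4_4"(1) s apply (elim disjE) subgoal by (erule s_untied.cases) (use s s_negative_imp_negative in auto) by auto
  then show ?case using "4_4" by auto
next
  case ("4_5" i n v)
  show ?case
  proof (cases "boxed_atom (Neg v)")
    case None
    then have s: "\<not> strongly_positive (Neg v)"
      using strongly_positive_shape by fastforce
    have "negative_fm (Neg v)" using "4_5"(1) s apply (elim disjE) subgoal by (erule s_untied.cases) (use s s_negative_imp_negative in auto) by auto
    then show ?thesis using "4_5" None by auto
  next
    case (Some a) then show ?thesis using "4_5" by (cases a) auto
  qed
qed

lemma holds_imps: "holds X R e (foldr FImp L F) \<longleftrightarrow> ((\<forall>d\<in>set L. holds X R e d) \<longrightarrow> holds X R e F)"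
  by (induction L) auto

lemma agree_outside_refl: "agree_outside X e e' m m \<longleftrightarrow> e' = e" unfolding agree_outside_def fun_eq_iff atLeastLessThan_iff by (meson leD)

lemma holds_alls: "n \<le> m \<Longrightarrow> holds X R e (foldr FAll [n..<m] F) \<longleftrightarrow> (\<forall>e'. agree_outside X e e' n m \<longrightarrow> holds X R e' F)"
proof (induction "m - n" arbitrary: n e)
  case 0 then show ?case by (simp add: agree_outside_refl)
next
  case (Suc k)
  have "holds X R e (foldr FAll [n..<m] F) \<longleftrightarrow> (\<forall>x\<in>X. holds X R (e(n:=x)) (foldr FAll [Suc n..<m] F))"
    using Suc by (simp add: upt_conv_Cons)
  also have "\<dots> \<longleftrightarrow> (\<forall>x\<in>X. \<forall>e'. agree_outside X (e(n:=x)) e' (Suc n) m \<longrightarrow> holds X R e' F)"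
    using Suc by simp
  also have "\<dots> \<longleftrightarrow> (\<forall>e'. agree_outside X e e' n m \<longrightarrow> holds X R e' F)"
  proof -
    have "agree_outside X e e' n m \<longleftrightarrow> (\<exists>x\<in>X. agree_outside X (e(n:=x)) e' (Suc n) m)" for e'
    proof
      assume a: "agree_outside X e e' n m"
      have "e' n \<in> X" using a Suc by (auto simp: agree_outside_def)
      moreover have "agree_outside X (e(n := e' n)) e' (Suc n) m" using a by (auto simp: agree_outside_def)
      ultimately show "\<exists>x\<in>X. agree_outside X (e(n:=x)) e' (Suc n) m" by blast
    next
      assume "\<exists>x\<in>X. agree_outside X (e(n:=x)) e' (Suc n) m"
      then obtain x where x: "x\<in>X" "agree_outside X (e(n:=x)) e' (Suc n) m" by blast
      then have "e' n = x" by (auto simp: agree_outside_def)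
      show "agree_outside X e e' n m" unfolding agree_outside_def
      proof (intro allI)
        fix i show "(i \<in> {n..<m} \<longrightarrow> e' i \<in> X) \<and> (i \<notin> {n..<m} \<longrightarrow> e' i = e i)"
          using x \<open>e' n = x\<close> Suc unfolding agree_outside_def by (cases "i = n") (auto dest!: spec[of _ i])
      qed
    qed
    then show ?thesis by blast
  qed
  finally show ?case .
qed

lemma corr_at_Imp:
  assumes "s_untied \<phi>1" "s_positive \<phi>2" "i < n" "e i \<in> X"
  shows "holds X R e (corr_at i n (Imp \<phi>1 \<phi>2)) \<longleftrightarrow> (\<forall>V::nat \<Rightarrow> _. (\<forall>p. V p \<subseteq> X) \<longrightarrow> e i \<in> eval X R V (Imp \<phi>1 \<phi>2))"
proof -
  obtain m D A N where d: "decompose i n \<phi>1 = (m,D,A,N)" by (metis surj_pair)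
  have e0: "X \<noteq> {}" using assms by blast
  note dc = decompose_correct[OF _ e0 d assms(3)]
  have nm: "n \<le> m" "vars_below m D A N" using dc[of "\<lambda>_. {}"] by auto
  have im: "i < m" using nm assms by simp
  have N: "\<forall>(\<psi>,j)\<in>set N. negative_fm \<psi>" using decompose_negs[OF _ d] assms(1) by blast
  have ei: "e' i = e i" if "agree_outside X e e' n m" for e' using that assms by (auto simp: agree_outside_def)
  have inX: "e' j \<in> X" if "agree_outside X e e' n m" "(\<psi>,j) \<in> set N" "\<forall>d\<in>set D. holds X R e' d" for e' \<psi> j
  proof -
    have "\<forall>(\<psi>,j)\<in>set N. j = i \<or> n \<le> j" using d assms(3)
    proof (induction i n \<phi>1 arbitrary: m D A N rule: decompose.induct)
      case (1 i n \<phi> \<psi>)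
      obtain n1 D1 A1 N1 where d1: "decompose i n \<phi> = (n1,D1,A1,N1)" by (metis surj_pair)
      obtain n2 D2 A2 N2 where d2: "decompose i n1 \<psi> = (n2,D2,A2,N2)" by (metis surj_pair)
      have "n \<le> n1" using decompose_correct[of "\<lambda>_. {}" "UNIV::nat set", OF _ _ d1] 1 by auto
      then have "i < n1" using 1 by simp
      with 1(1)[OF d1] 1(2)[OF d1[symmetric] refl refl refl d2] 1(3,4) d1 d2 \<open>n \<le> n1\<close>
      show ?case by fastforce
    next
      case (2 i n \<phi>) then show ?case by (fastforce split: prod.splits)
    next
      case (3 i n \<phi>) then show ?case by (fastforce split: prod.splits)
    qed (auto split: option.splits)
    with that nm assms ei show ?thesis unfolding vars_below_def agree_outside_def
      by (metis (mono_tags, lifting) atLeastLessThan_iff case_prodD)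
  qed
  have st: "holds X R e' (st A j m \<psi>) \<longleftrightarrow> e' j \<in> eval X R (min_valuation X R e' A) \<psi>" if "j < m" "e' j \<in> X" for e' j \<psi>
    using holds_st that nm unfolding vars_below_def by blast
  have "holds X R e (corr_at i n (Imp \<phi>1 \<phi>2)) \<longleftrightarrow>
    (\<forall>e'. agree_outside X e e' n m \<longrightarrow> (\<forall>d\<in>set D. holds X R e' d) \<longrightarrow> (\<forall>(\<psi>,j)\<in>set N. holds X R e' (st A j m \<psi>))
      \<longrightarrow> holds X R e' (st A i m \<phi>2))"
    using d nm by (auto simp: holds_alls holds_imps)
  also have "\<dots> \<longleftrightarrow> (\<forall>e'. agree_outside X e e' n m \<longrightarrow> (\<forall>d\<in>set D. holds X R e' d) \<longrightarrow> (\<forall>(\<psi>,j)\<in>set N. e' j \<in> eval X R (min_valuation X R e' A) \<psi>)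
      \<longrightarrow> e i \<in> eval X R (min_valuation X R e' A) \<phi>2)" (is "_ \<longleftrightarrow> (\<forall>e'. ?P e')")
  proof -
    have "(\<forall>(\<psi>,j)\<in>set N. holds X R e' (st A j m \<psi>)) \<longleftrightarrow> (\<forall>(\<psi>,j)\<in>set N. e' j \<in> eval X R (min_valuation X R e' A) \<psi>)"
      if "agree_outside X e e' n m" "\<forall>d\<in>set D. holds X R e' d" for e'
    proof (rule ball_cong[OF refl], clarify)
      fix \<psi> j assume "(\<psi>,j) \<in> set N"
      then show "holds X R e' (st A j m \<psi>) \<longleftrightarrow> e' j \<in> eval X R (min_valuation X R e' A) \<psi>"
        using st inX[OF that(1) _ that(2)] nm unfolding vars_below_def by blast
    qed
    moreover have "holds X R e' (st A i m \<phi>2) \<longleftrightarrow> e i \<in> eval X R (min_valuation X R e' A) \<phi>2" if "agree_outside X e e' n m" for e'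
      using st[of i e' \<phi>2] ei[OF that] assms im by simp
    ultimately show ?thesis by meson
  qed
  also have "\<dots> \<longleftrightarrow> (\<forall>V::nat \<Rightarrow> _. (\<forall>p. V p \<subseteq> X) \<longrightarrow> e i \<in> eval X R V (Imp \<phi>1 \<phi>2))"
  proof
    assume L: "\<forall>e'. ?P e'"
    show "\<forall>V. (\<forall>p. V p \<subseteq> X) \<longrightarrow> e i \<in> eval X R V (Imp \<phi>1 \<phi>2)"
    proof (intro allI impI)
      fix V :: "nat \<Rightarrow> _" assume V: "\<forall>p. V p \<subseteq> X"
      have "e i \<in> eval X R V \<phi>2" if h: "e i \<in> eval X R V \<phi>1"
      proof -
        obtain e' where e': "agree_outside X e e' n m" "decomposition_true X R V e' D A N" using dc[of V, OF V[rule_format]] h assms(4) by blast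
        have sub: "min_valuation X R e' A p \<subseteq> V p" for p
        proof
          fix v assume "v \<in> min_valuation X R e' A p"
          then obtain cs j where "(p,cs,j)\<in>set A" "colour_reach X R cs (e' j) v" "v\<in>X" unfolding min_valuation_def by auto
          with e'(2) show "v \<in> V p" unfolding decomposition_true_def by blast
        qed
        have "\<forall>(\<psi>,j)\<in>set N. e' j \<in> eval X R (min_valuation X R e' A) \<psi>"
          using e'(2) N eval_antimono_negative[of _ "min_valuation X R e' A" V, OF _ sub] unfolding decomposition_true_def by blast
        then have "e i \<in> eval X R (min_valuation X R e' A) \<phi>2" using L e' unfolding decomposition_true_def by blast
        then show ?thesis using eval_mono_positive[OF s_positive_imp_positive[OF assms(2)], of "min_valuation X R e' A" V, OF sub] by blast
      qed
      then show "e i \<in> eval X R V (Imp \<phi>1 \<phi>2)" using assms by auto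
    qed
  next
    assume Rr: "\<forall>V. (\<forall>p. V p \<subseteq> X) \<longrightarrow> e i \<in> eval X R V (Imp \<phi>1 \<phi>2)"
    show "\<forall>e'. ?P e'"
    proof (intro allI impI)
      fix e' assume a: "agree_outside X e e' n m" "\<forall>d\<in>set D. holds X R e' d" "\<forall>(\<psi>,j)\<in>set N. e' j \<in> eval X R (min_valuation X R e' A) \<psi>"
      have "decomposition_true X R (min_valuation X R e' A) e' D A N" using a unfolding decomposition_true_def by (fastforce simp: min_valuation_def)
      then have "e i \<in> eval X R (min_valuation X R e' A) \<phi>1" using dc[of "min_valuation X R e' A"] a(1) assms by (auto simp: min_valuation_def)
      then show "e i \<in> eval X R (min_valuation X R e' A) \<phi>2" using Rr[rule_format, of "min_valuation X R e' A"] by (auto simp: min_valuation_def)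
    qed
  qed
  finally show ?thesis .
qed

definition corr_ok where "corr_ok X R \<phi> \<longleftrightarrow> (\<forall>i n e. i < n \<longrightarrow> e i \<in> X \<longrightarrow>
  holds X R e (corr_at i n \<phi>) = (\<forall>V::nat \<Rightarrow> _. (\<forall>p. V p \<subseteq> X) \<longrightarrow> e i \<in> eval X R V \<phi>))"

lemma corr_ok_Imp: "s_untied \<phi>1 \<Longrightarrow> s_positive \<phi>2 \<Longrightarrow> corr_ok X R (Imp \<phi>1 \<phi>2)"
  unfolding corr_ok_def using corr_at_Imp by blast

lemma corr_ok_Box: assumes "corr_ok X R \<phi>" shows "corr_ok X R (Box \<phi>)"
  unfolding corr_ok_def
proof (intro allI impI)
  fix i n e assume a: "(i::nat) < n" "e i \<in> X"
  have "holds X R (e(n:=x)) (corr_at n (Suc n) \<phi>) = (\<forall>V. (\<forall>p. V p \<subseteq> X) \<longrightarrow> x \<in> eval X R V \<phi>)" if "x\<in>X" for x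
    using assms that unfolding corr_ok_def by (metis fun_upd_same lessI)
  then have "holds X R e (corr_at i n (Box \<phi>)) = (\<forall>x\<in>X. R (e i) x \<longrightarrow> (\<forall>V. (\<forall>p. V p \<subseteq> X) \<longrightarrow> x \<in> eval X R V \<phi>))"
    using a by simp
  moreover have "e i \<in> eval X R V (Box \<phi>) \<longleftrightarrow> (\<forall>x\<in>X. R (e i) x \<longrightarrow> x \<in> eval X R V \<phi>)" for V
    using a by auto
  ultimately show "holds X R e (corr_at i n (Box \<phi>)) = (\<forall>V::nat \<Rightarrow> _. (\<forall>p. V p \<subseteq> X) \<longrightarrow> e i \<in> eval X R V (Box \<phi>))"
    by (simp del: eval.simps) blast
qed
lemma corr_ok_BBox: assumes "corr_ok X R \<phi>" shows "corr_ok X R (BBox \<phi>)"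
  unfolding corr_ok_def
proof (intro allI impI)
  fix i n e assume a: "(i::nat) < n" "e i \<in> X"
  have "holds X R (e(n:=x)) (corr_at n (Suc n) \<phi>) = (\<forall>V. (\<forall>p. V p \<subseteq> X) \<longrightarrow> x \<in> eval X R V \<phi>)" if "x\<in>X" for x
    using assms that unfolding corr_ok_def by (metis fun_upd_same lessI)
  then have "holds X R e (corr_at i n (BBox \<phi>)) = (\<forall>x\<in>X. R x (e i) \<longrightarrow> (\<forall>V. (\<forall>p. V p \<subseteq> X) \<longrightarrow> x \<in> eval X R V \<phi>))"
    using a by simp
  moreover have "e i \<in> eval X R V (BBox \<phi>) \<longleftrightarrow> (\<forall>x\<in>X. R x (e i) \<longrightarrow> x \<in> eval X R V \<phi>)" for V
    using a by auto
  ultimately show "holds X R e (corr_at i n (BBox \<phi>)) = (\<forall>V::nat \<Rightarrow> _. (\<forall>p. V p \<subseteq> X) \<longrightarrow> e i \<in> eval X R V (BBox \<phi>))"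
    by (simp del: eval.simps) blast
qed
lemma corr_ok_power: "corr_ok X R \<phi> \<Longrightarrow> corr_ok X R (((\<lambda>\<psi>. Box \<psi>) ^^ m) \<phi>)"
   "corr_ok X R \<phi> \<Longrightarrow> corr_ok X R (((\<lambda>\<psi>. BBox \<psi>) ^^ m) \<phi>)"
  by (induction m) (simp_all add: corr_ok_Box corr_ok_BBox del: corr_at.simps)
lemma corr_ok_boxes: "corr_ok X R \<phi> \<Longrightarrow> corr_ok X R (boxes \<mu> \<phi>)" "corr_ok X R \<phi> \<Longrightarrow> corr_ok X R (bboxes \<mu> \<phi>)"
  by (induction \<mu> \<phi> and \<mu> \<phi> rule: boxes_bboxes.induct) (simp_all add: corr_ok_power)

lemma classical_correspondence:
  assumes "s_sahlqvist \<phi>"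
  shows "models X R (sahlqvist_correspondent \<phi>) \<longleftrightarrow> (\<forall>V. (\<forall>p. V p \<subseteq> X) \<longrightarrow> eval X R V \<phi> = X)"
proof -
  have ok: "corr_ok X R \<phi>" using assms unfolding s_sahlqvist_def
    using corr_ok_boxes(1)[OF corr_ok_Imp] by blast
  have h: "holds X R (e(0:=x)) (corr_at 0 1 \<phi>) \<longleftrightarrow> (\<forall>V. (\<forall>p. V p \<subseteq> X) \<longrightarrow> x \<in> eval X R V \<phi>)" if "x \<in> X" for e x
    using ok[unfolded corr_ok_def, rule_format, of 0 1 "e(0:=x)"] that by simp
  have "models X R (sahlqvist_correspondent \<phi>) \<longleftrightarrow> (\<forall>e. \<forall>x\<in>X. holds X R (e(0:=x)) (corr_at 0 1 \<phi>))"
    unfolding models_def sahlqvist_correspondent_def by (simp only: holds.simps)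
  also have "\<dots> \<longleftrightarrow> (\<forall>x\<in>X. \<forall>V. (\<forall>p. V p \<subseteq> X) \<longrightarrow> x \<in> eval X R V \<phi>)" using h by simp
  also have "\<dots> \<longleftrightarrow> (\<forall>V. (\<forall>p. V p \<subseteq> X) \<longrightarrow> X \<subseteq> eval X R V \<phi>)" by blast
  also have "\<dots> \<longleftrightarrow> (\<forall>V. (\<forall>p. V p \<subseteq> X) \<longrightarrow> eval X R V \<phi> = X)"
  proof -
    have "eval X R V \<phi> \<subseteq> X" if "\<forall>p. V p \<subseteq> X" for V using eval_subset[of V X R \<phi>] that by blast
    then show ?thesis by (metis subset_antisym subset_refl)
  qed
  finally show ?thesis .
qed

end

(*
  By the classical correspondence theorem it suffices to pass from clopen valuations to arbitrary ones,
  pointwise on the Stone space X. If x satisfies the s-untied antecedent under a valuation V, then the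
  boxed atoms are already true under a valuation M below V by closed sets, because images of
  closed sets under the closed relation R and its converse are closed. By an Esakia-type argument, on
  closed valuations an s-positive formula is the intersection of its values over the larger clopen
  valuations, and dually an s-negative one is the union. So the antecedent persists to
  all clopen valuations between M and some clopen U above M; validity then yields the consequent at
  all small clopen valuations above M, hence at M, and by monotonicity at V.
*)
theory Submission
  imports Defs
begin

section \<open>Closed sets of the Stone space\<close>

text \<open>The prime ideal theorem, from which all compactness below is drawn. Zorn yields a filter
  \<open>M\<close> maximal among those containing \<open>F\<close> and missing \<open>I\<close>; if
  neither \<open>a\<close> nor \<open>- a\<close> were in \<open>M\<close>, enlarging by either one
  would hit \<open>I\<close>, and then \<open>M\<close> itself would.\<close>

lemma filter_extends_to_ultrafilter_avoiding_ideal: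
  assumes F: "is_filter F" and I: "is_ideal I" and disj: "F \<inter> I = {}"
  obtains x where "x \<in> Ult" "F \<subseteq> x" "x \<inter> I = {}"
proof -
  define \<F> where "\<F> = {G. is_filter G \<and> F \<subseteq> G \<and> G \<inter> I = {}}"
  have "\<exists>M\<in>\<F>. \<forall>G\<in>\<F>. M \<subseteq> G \<longrightarrow> G = M"
  proof (rule subset_Zorn_nonempty)
    show "\<F> \<noteq> {}" using F disj by (auto simp: \<F>_def)
    fix \<C> assume ne: "\<C> \<noteq> {}" and chain: "subset.chain \<F> \<C>"
    have sub: "G \<in> \<F>" if "G \<in> \<C>" for G using chain that by (auto simp: subset_chain_def)
    have "is_filter (\<Union>\<C>)" unfolding is_filter_def
    proof (intro conjI ballI allI impI)
      show "top \<in> \<Union>\<C>" using ne sub by (fastforce simp: \<F>_def is_filter_def)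
    next
      fix a b assume "a \<in> \<Union>\<C>" "b \<in> \<Union>\<C>"
      then obtain G H where GH: "G \<in> \<C>" "a \<in> G" "H \<in> \<C>" "b \<in> H" by blast
      have "G \<subseteq> H \<or> H \<subseteq> G" using chain GH by (auto simp: subset_chain_def)
      then obtain K where "K \<in> \<C>" "a \<in> K" "b \<in> K" using GH by blast
      then show "inf a b \<in> \<Union>\<C>" using sub[of K] by (auto simp: \<F>_def is_filter_def)
    next
      fix a b :: 'a assume "a \<in> \<Union>\<C>" "a \<le> b"
      then show "b \<in> \<Union>\<C>" using sub by (fastforce simp: \<F>_def is_filter_def)
    qed
    moreover have "F \<subseteq> \<Union>\<C>" "\<Union>\<C> \<inter> I = {}" using ne sub by (auto simp: \<F>_def)
    ultimately show "\<Union>\<C> \<in> \<F>" by (simp add: \<F>_def)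
  qed
  then obtain M where M: "M \<in> \<F>" and maximal: "\<And>G. G \<in> \<F> \<Longrightarrow> M \<subseteq> G \<Longrightarrow> G = M" by blast
  have MF: "is_filter M" "F \<subseteq> M" "M \<inter> I = {}" using M by (auto simp: \<F>_def)
  have meets: "\<exists>m\<in>M. inf m a \<in> I" if a: "a \<notin> M" for a
  proof (rule ccontr)
    assume no: "\<not> (\<exists>m\<in>M. inf m a \<in> I)"
    \<comment> \<open>The filter generated by \<open>M\<close> and \<open>a\<close>; it misses
      \<open>I\<close> because \<open>I\<close> is closed downwards.\<close>
    let ?G = "{c. \<exists>m\<in>M. inf m a \<le> c}"
    have "is_filter ?G" unfolding is_filter_def
    proof (intro conjI ballI allI impI)
      show "top \<in> ?G" using MF(1) by (auto simp: is_filter_def)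
    next
      fix c d assume "c \<in> ?G" "d \<in> ?G"
      then obtain m n where mn: "m \<in> M" "n \<in> M" "inf m a \<le> c" "inf n a \<le> d" by blast
      then have "inf (inf m n) a \<le> inf c d" by (meson inf.bounded_iff inf.cobounded1 inf.cobounded2 order_trans)
      moreover have "inf m n \<in> M" using MF(1) mn by (auto simp: is_filter_def)
      ultimately show "inf c d \<in> ?G" by blast
    next
      fix c d assume "c \<in> ?G" "c \<le> d"
      then show "d \<in> ?G" by (auto intro: order_trans)
    qed
    moreover have "M \<subseteq> ?G" by (auto intro: inf.cobounded1)
    moreover have "?G \<inter> I = {}" using I no by (auto simp: is_ideal_def)
    ultimately have "?G = M" using MF(2) by (intro maximal) (auto simp: \<F>_def)
    moreover have "a \<in> ?G" using MF(1) by (auto simp: is_filter_def)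
    ultimately show False using a by simp
  qed
  have "a \<in> M \<or> - a \<in> M" for a
  proof (rule ccontr)
    assume "\<not> (a \<in> M \<or> - a \<in> M)"
    then obtain m n where mn: "m \<in> M" "n \<in> M" "inf m a \<in> I" "inf n (- a) \<in> I" using meets by meson
    \<comment> \<open>Splitting along \<open>a\<close> and \<open>- a\<close> puts
      \<open>inf m n\<close> below the join of two members of \<open>I\<close>.\<close>
    have "inf m n = sup (inf (inf m n) a) (inf (inf m n) (- a))"
      by (simp flip: inf_sup_distrib1)
    also have "\<dots> \<le> sup (inf m a) (inf n (- a))" by (intro sup_mono inf_mono) auto
    finally have "inf m n \<in> I" using I mn by (auto simp: is_ideal_def)
    moreover have "inf m n \<in> M" using MF(1) mn by (auto simp: is_filter_def)
    ultimately show False using MF(3) by blast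
  qed
  moreover have "bot \<notin> M" using I MF(3) by (auto simp: is_ideal_def)
  ultimately have "M \<in> Ult" using MF(1) by (simp add: Ult_def is_ultrafilter_def)
  then show thesis using MF(2,3) by (rule that)
qed

section \<open>Ultrafilters and the Stone map\<close>

lemma Ult_top: "x \<in> Ult \<Longrightarrow> top \<in> x"
  and Ult_bot: "x \<in> Ult \<Longrightarrow> bot \<notin> x"
  and Ult_mono: "x \<in> Ult \<Longrightarrow> a \<in> x \<Longrightarrow> a \<le> b \<Longrightarrow> b \<in> x"
  unfolding Ult_def is_ultrafilter_def is_filter_def by blast+

lemma Ult_inf_iff: "x \<in> Ult \<Longrightarrow> inf a b \<in> x \<longleftrightarrow> a \<in> x \<and> b \<in> x"
proof
  assume x: "x \<in> Ult"
  show "a \<in> x \<and> b \<in> x" if "inf a b \<in> x"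
    using Ult_mono[OF x that inf.cobounded1] Ult_mono[OF x that inf.cobounded2] ..
  show "inf a b \<in> x" if "a \<in> x \<and> b \<in> x"
    using x that unfolding Ult_def is_ultrafilter_def is_filter_def by blast
qed

lemma Ult_uminus_iff: "x \<in> Ult \<Longrightarrow> - a \<in> x \<longleftrightarrow> a \<notin> x"
  using Ult_inf_iff[of x a "- a"] Ult_bot[of x] by (auto simp: Ult_def is_ultrafilter_def)

lemma Ult_sup_iff: "x \<in> Ult \<Longrightarrow> sup a b \<in> x \<longleftrightarrow> a \<in> x \<or> b \<in> x"
  using Ult_inf_iff[of x "- a" "- b"] Ult_uminus_iff[of x a] Ult_uminus_iff[of x b]
    Ult_uminus_iff[of x "sup a b"] unfolding compl_sup by blast

lemma stone_subset_Ult: "stone b \<subseteq> Ult"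
  by (auto simp: stone_def)

lemma stone_top: "stone top = Ult"
  by (auto simp: stone_def Ult_top)

lemma stone_inf: "stone (inf a b) = stone a \<inter> stone b"
  by (auto simp: stone_def Ult_inf_iff)

lemma stone_mono: "a \<le> b \<Longrightarrow> stone a \<subseteq> stone b"
  by (auto simp: stone_def intro: Ult_mono)

text \<open>Topological closedness without a topology: the clopen sets form a base, so a closed set
  is the intersection of the clopen sets containing it.\<close>

definition stone_closed :: "'a::boolean_algebra set set \<Rightarrow> bool" where
  "stone_closed C \<longleftrightarrow> C \<subseteq> Ult \<and> (\<forall>x\<in>Ult. (\<forall>a. C \<subseteq> stone a \<longrightarrow> a \<in> x) \<longrightarrow> x \<in> C)"

lemma stone_closed_separate:
  assumes "stone_closed C" "x \<in> Ult" "x \<notin> C"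
  obtains a where "C \<subseteq> stone a" "a \<notin> x"
  using assms unfolding stone_closed_def by meson

lemma stone_closed_stone: "stone_closed (stone b)"
  by (auto simp: stone_closed_def stone_def)

lemma stone_closed_Ult: "stone_closed Ult"
  by (simp add: stone_closed_def)

lemma stone_closed_empty: "stone_closed {}"
  using Ult_bot by (auto simp: stone_closed_def)

lemma stone_closed_singleton: "x \<in> Ult \<Longrightarrow> stone_closed {x}"
  unfolding stone_closed_def
proof (intro conjI ballI impI)
  fix y assume x: "x \<in> Ult" and y: "y \<in> Ult" and all: "\<forall>a. {x} \<subseteq> stone a \<longrightarrow> a \<in> y"
  \<comment> \<open>Testing both \<open>a\<close> and \<open>- a\<close> turns the inclusion of
    \<open>x\<close> in \<open>y\<close> into equality.\<close>
  have "a \<in> x \<longleftrightarrow> a \<in> y" for a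
    using all[rule_format, of a] all[rule_format, of "- a"] x y Ult_uminus_iff[of _ a] by (auto simp: stone_def)
  then show "y \<in> {x}" by blast
qed simp

lemma stone_closed_Int:
  assumes "stone_closed C" "stone_closed D"
  shows "stone_closed (C \<inter> D)"
  unfolding stone_closed_def
proof (intro conjI ballI impI)
  show "C \<inter> D \<subseteq> Ult" using assms by (auto simp: stone_closed_def)
  fix x :: "'a set" assume x: "x \<in> Ult" and all: "\<forall>a. C \<inter> D \<subseteq> stone a \<longrightarrow> a \<in> x"
  have "a \<in> x" if "C \<subseteq> stone a" for a using all le_infI1[OF that] by blast
  moreover have "a \<in> x" if "D \<subseteq> stone a" for a using all le_infI2[OF that] by blast
  ultimately show "x \<in> C \<inter> D" using assms x by (simp add: stone_closed_def)
qed

lemma stone_closed_Un: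
  assumes "stone_closed C" "stone_closed D"
  shows "stone_closed (C \<union> D)"
  unfolding stone_closed_def
proof (intro conjI ballI impI)
  show "C \<union> D \<subseteq> Ult" using assms by (auto simp: stone_closed_def)
  fix x :: "'a set" assume x: "x \<in> Ult" and all: "\<forall>a. C \<union> D \<subseteq> stone a \<longrightarrow> a \<in> x"
  show "x \<in> C \<union> D"
  proof (rule ccontr)
    assume "x \<notin> C \<union> D"
    then have "x \<notin> C" "x \<notin> D" by blast+
    then obtain a b where ab: "C \<subseteq> stone a" "a \<notin> x" "D \<subseteq> stone b" "b \<notin> x"
      using stone_closed_separate[OF assms(1) x] stone_closed_separate[OF assms(2) x] by metis
    then have "C \<union> D \<subseteq> stone (sup a b)" by (auto simp: stone_def Ult_sup_iff)
    then have "sup a b \<in> x" using all by blast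
    then show False using ab x by (simp add: Ult_sup_iff)
  qed
qed

section \<open>Compactness\<close>

lemma is_filter_clopen_supersets:
  assumes "C \<subseteq> Ult"
  shows "is_filter {a. C \<subseteq> stone a}"
  unfolding is_filter_def
proof (intro conjI ballI allI impI)
  show "top \<in> {a. C \<subseteq> stone a}" using assms by (simp add: stone_top)
next
  fix a b assume "a \<in> {a. C \<subseteq> stone a}" "b \<in> {a. C \<subseteq> stone a}"
  then show "inf a b \<in> {a. C \<subseteq> stone a}" by (simp add: stone_inf)
next
  fix a b :: 'a assume "a \<in> {a. C \<subseteq> stone a}" "a \<le> b"
  then show "b \<in> {a. C \<subseteq> stone a}" using stone_mono[of a b] by simp
qed

text \<open>Compactness in covering form. An ideal has finite joins, so a finite subcover amounts to
  a single member. Were there none, an ultrafilter would extend the filter of clopen supersets of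
  \<open>C\<close> and avoid \<open>I\<close>; being in the closed set \<open>C\<close>, it would be
  an uncovered point.\<close>

lemma stone_closed_cover_by_ideal:
  assumes C: "stone_closed C" and I: "is_ideal I" and cover: "\<And>x. x \<in> C \<Longrightarrow> \<exists>a\<in>I. a \<in> x"
  obtains a where "a \<in> I" "C \<subseteq> stone a"
proof (rule ccontr)
  assume "\<not> thesis"
  then have "{a. C \<subseteq> stone a} \<inter> I = {}" using that by blast
  then obtain x where x: "x \<in> Ult" "{a. C \<subseteq> stone a} \<subseteq> x" "x \<inter> I = {}"
    using filter_extends_to_ultrafilter_avoiding_ideal I is_filter_clopen_supersets C
    by (metis stone_closed_def)
  then have "x \<in> C" using C by (auto simp: stone_closed_def)
  then show False using cover x by blast
qed

text \<open>Compactness in intersection form. The clopen sets above some member of the family form a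
  filter, proper because no member is empty; an ultrafilter extending it lies in every member by
  closedness.\<close>

lemma directed_stone_closed_Inter_nonempty:
  assumes ne: "\<C> \<noteq> {}" and closed: "\<And>C. C \<in> \<C> \<Longrightarrow> stone_closed C \<and> C \<noteq> {}"
    and directed: "\<And>C D. C \<in> \<C> \<Longrightarrow> D \<in> \<C> \<Longrightarrow> \<exists>E\<in>\<C>. E \<subseteq> C \<inter> D"
  shows "\<Inter>\<C> \<noteq> {}"
proof -
  define F where "F = {a. \<exists>C\<in>\<C>. C \<subseteq> stone a}"
  have "is_filter F" unfolding is_filter_def
  proof (intro conjI ballI allI impI)
    obtain C where "C \<in> \<C>" using ne by blast
    moreover have "C \<subseteq> stone top" using closed[OF \<open>C \<in> \<C>\<close>] by (simp add: stone_closed_def stone_top)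
    ultimately show "top \<in> F" unfolding F_def by blast
  next
    fix a b assume "a \<in> F" "b \<in> F"
    then obtain C D where C: "C \<in> \<C>" "C \<subseteq> stone a" and D: "D \<in> \<C>" "D \<subseteq> stone b" by (auto simp: F_def)
    obtain E where E: "E \<in> \<C>" "E \<subseteq> C \<inter> D" using directed[OF C(1) D(1)] by blast
    then have "E \<subseteq> stone (inf a b)" using C(2) D(2) unfolding stone_inf by blast
    then show "inf a b \<in> F" using E(1) unfolding F_def by blast
  next
    fix a b assume "a \<in> F" and ab: "a \<le> b"
    then obtain C where C: "C \<in> \<C>" "C \<subseteq> stone a" by (auto simp: F_def)
    have "C \<subseteq> stone b" using C(2) stone_mono[OF ab] by (rule subset_trans)
    then show "b \<in> F" using C(1) unfolding F_def by blast
  qed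
  moreover have "is_ideal {bot :: 'a}" by (auto simp: is_ideal_def bot_unique)
  moreover have "F \<inter> {bot} = {}" using closed Ult_bot by (fastforce simp: F_def stone_def)
  ultimately obtain x where x: "x \<in> Ult" "F \<subseteq> x" by (rule filter_extends_to_ultrafilter_avoiding_ideal)
  then have "x \<in> C" if "C \<in> \<C>" for C
    using closed[OF that] that unfolding stone_closed_def F_def by blast
  then show ?thesis by blast
qed


section \<open>Closed relations\<close>

text \<open>Closedness in the product space: each pair outside \<open>R\<close> has a clopen
  rectangle around it that misses \<open>R\<close>.\<close>

definition stone_closed_rel :: "('a::boolean_algebra set \<Rightarrow> 'a set \<Rightarrow> bool) \<Rightarrow> bool" where
  "stone_closed_rel R \<longleftrightarrow> (\<forall>x\<in>Ult. \<forall>y\<in>Ult. \<not> R x y \<longrightarrow>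
    (\<exists>a\<in>x. \<exists>b\<in>y. \<forall>x'\<in>stone a. \<forall>y'\<in>stone b. \<not> R x' y'))"

text \<open>A failure at \<open>x\<close>, \<open>y\<close> is witnessed by one pair
  \<open>prec b c\<close> with \<open>b\<close> in \<open>y\<close> and \<open>c\<close> outside
  \<open>x\<close>. The same pair refutes the relation on the whole rectangle
  \<open>stone (- c)\<close> times \<open>stone b\<close>.\<close>

lemma stone_closed_rel_dual_rel: "stone_closed_rel (dual_rel prec)"
  unfolding stone_closed_rel_def
proof (intro ballI impI)
  fix x y :: "'a set" assume xy: "x \<in> Ult" "y \<in> Ult" "\<not> dual_rel prec x y"
  then obtain b c where bc: "b \<in> y" "prec b c" "c \<notin> x" by (auto simp: dual_rel_def)
  have "\<not> dual_rel prec x' y'" if "x' \<in> stone (- c)" "y' \<in> stone b" for x' y'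
    using that bc(2) by (auto simp: stone_def dual_rel_def Ult_uminus_iff)
  then show "\<exists>a\<in>x. \<exists>b\<in>y. \<forall>x'\<in>stone a. \<forall>y'\<in>stone b. \<not> dual_rel prec x' y'"
    using bc xy Ult_uminus_iff by blast
qed

lemma stone_closed_rel_conversep: "stone_closed_rel R \<Longrightarrow> stone_closed_rel R\<inverse>\<inverse>"
  unfolding stone_closed_rel_def conversep_iff by meson

text \<open>A tube argument: every point of \<open>C\<close> can be separated by a clopen rectangle
  from a point \<open>y\<close> outside the image, and compactness of \<open>C\<close> merges these
  rectangles into one.\<close>

lemma stone_closed_image:
  assumes R: "stone_closed_rel R" and C: "stone_closed C"
  shows "stone_closed {y \<in> Ult. \<exists>x\<in>C. R x y}" (is "stone_closed ?D")
  unfolding stone_closed_def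
proof (intro conjI ballI impI)
  show "?D \<subseteq> Ult" by blast
  fix y assume y: "y \<in> Ult" and all: "\<forall>a. ?D \<subseteq> stone a \<longrightarrow> a \<in> y"
  show "y \<in> ?D"
  proof (rule ccontr)
    assume "y \<notin> ?D"
    \<comment> \<open>The clopen sets whose image misses some clopen neighbourhood of
      \<open>y\<close>. Joins in \<open>I\<close> are matched by meets of the
      neighbourhoods.\<close>
    define I where "I = {a. \<exists>b\<in>y. \<forall>x'\<in>stone a. \<forall>y'\<in>stone b. \<not> R x' y'}"
    have "is_ideal I" unfolding is_ideal_def
    proof (intro conjI ballI allI impI)
      show "bot \<in> I" using y Ult_top Ult_bot by (auto simp: I_def stone_def)
    next
      fix a b assume "a \<in> I" "b \<in> I"
      then obtain c d where cd: "c \<in> y" "d \<in> y"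
        "\<forall>x'\<in>stone a. \<forall>y'\<in>stone c. \<not> R x' y'" "\<forall>x'\<in>stone b. \<forall>y'\<in>stone d. \<not> R x' y'"
        by (auto simp: I_def)
      then have "\<forall>x'\<in>stone (sup a b). \<forall>y'\<in>stone (inf c d). \<not> R x' y'"
        by (auto simp: stone_def Ult_sup_iff Ult_inf_iff)
      moreover have "inf c d \<in> y" using cd y by (simp add: Ult_inf_iff)
      ultimately show "sup a b \<in> I" by (auto simp: I_def)
    next
      fix a b assume "a \<in> I" "b \<le> a"
      then have "stone b \<subseteq> stone a" by (simp add: stone_mono)
      then show "b \<in> I" using \<open>a \<in> I\<close> unfolding I_def by blast
    qed
    moreover have "\<exists>a\<in>I. a \<in> x" if "x \<in> C" for x
    proof -
      have "x \<in> Ult" "\<not> R x y" using C that y \<open>y \<notin> ?D\<close> by (auto simp: stone_closed_def)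
      then obtain a b where "a \<in> x" "b \<in> y" "\<forall>x'\<in>stone a. \<forall>y'\<in>stone b. \<not> R x' y'"
        using R y unfolding stone_closed_rel_def by meson
      then show ?thesis by (auto simp: I_def)
    qed
    ultimately obtain a where a: "a \<in> I" "C \<subseteq> stone a"
      using stone_closed_cover_by_ideal C by blast
    then obtain b where b: "b \<in> y" "\<forall>x'\<in>stone a. \<forall>y'\<in>stone b. \<not> R x' y'" by (auto simp: I_def)
    then have "\<not> (\<exists>x\<in>C. R x y')" if "y' \<in> stone b" for y' using a that by blast
    then have "?D \<subseteq> stone (- b)" by (auto simp: stone_def Ult_uminus_iff)
    then show False using all b y Ult_uminus_iff by blast
  qed
qed


section \<open>Esakia's lemma\<close>

abbreviation stone_val :: "(nat \<Rightarrow> 'a::boolean_algebra) \<Rightarrow> nat \<Rightarrow> 'a set set" where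
  "stone_val v \<equiv> \<lambda>p. stone (v p)"

lemma le_stone_val_top: "(\<And>p. F p \<subseteq> Ult) \<Longrightarrow> F \<le> stone_val top"
  by (simp add: le_fun_def stone_top)

text \<open>Makes the clopen valuations above \<open>F\<close> downward directed, as the compactness
  arguments require.\<close>

lemma le_stone_val_inf_iff: "F \<le> stone_val (inf u v) \<longleftrightarrow> F \<le> stone_val u \<and> F \<le> stone_val v"
  by (auto simp: le_fun_def stone_inf)

lemma eval_mono: "positive_fm \<phi> \<Longrightarrow> V \<le> W \<Longrightarrow> eval X R V \<phi> \<subseteq> eval X R W \<phi>"
  by (rule eval_mono_positive) (auto simp: le_fun_def)

lemma eval_stone_val_inf:
  assumes "positive_fm \<phi>"
  shows "eval X R (stone_val (inf u v)) \<phi> \<subseteq> eval X R (stone_val u) \<phi> \<inter> eval X R (stone_val v) \<phi>"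
  by (intro Int_greatest eval_mono_positive[OF assms]) (simp_all add: stone_inf)

lemma eval_antimono: "negative_fm \<phi> \<Longrightarrow> V \<le> W \<Longrightarrow> eval X R W \<phi> \<subseteq> eval X R V \<phi>"
  by (rule eval_antimono_negative) (auto simp: le_fun_def)

lemma positive_fm_inversions:
  "positive_fm (Or \<phi> \<psi>) \<Longrightarrow> positive_fm \<phi> \<and> positive_fm \<psi>"
  "positive_fm (And \<phi> \<psi>) \<Longrightarrow> positive_fm \<phi> \<and> positive_fm \<psi>"
  "positive_fm (Dia \<phi>) \<Longrightarrow> positive_fm \<phi>"
  "positive_fm (BDia \<phi>) \<Longrightarrow> positive_fm \<phi>"
  by (auto elim: positive_fm.cases)

lemma negative_fm_inversions:
  "\<not> negative_fm (Var p)"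
  "negative_fm (Or \<phi> \<psi>) \<Longrightarrow> negative_fm \<phi> \<and> negative_fm \<psi>"
  "negative_fm (And \<phi> \<psi>) \<Longrightarrow> negative_fm \<phi> \<and> negative_fm \<psi>"
  "negative_fm (Box \<phi>) \<Longrightarrow> negative_fm \<phi>"
  "negative_fm (BBox \<phi>) \<Longrightarrow> negative_fm \<phi>"
  by (auto elim: negative_fm.cases)

lemma stone_closed_eval_closed_fm:
  assumes "closed_fm \<phi>" and R: "stone_closed_rel R"
  shows "stone_closed (eval Ult R (stone_val v) \<phi>)"
  using assms(1)
proof induction
  case (4 p)
  \<comment> \<open>Here the valuation has to be clopen and not merely closed.\<close>
  have "eval Ult R (stone_val v) (Neg (Var p)) = stone (- v p)"
    by (auto simp: stone_def Ult_uminus_iff)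
  then show ?case by (simp only: stone_closed_stone)
next
  case (7 \<phi>)
  then show ?case using stone_closed_image[OF stone_closed_rel_conversep[OF R] 7(2)] by simp
next
  case (8 \<phi>)
  then show ?case using stone_closed_image[OF R 8(2)] by simp
qed (simp_all add: stone_closed_stone stone_closed_Ult stone_closed_empty stone_closed_Un stone_closed_Int)

text \<open>The compactness step of Esakia's lemma: the \<open>S\<close>-successors of
  \<open>x\<close> satisfying \<phi> under \<open>v\<close> form a nonempty closed set that shrinks
  with \<open>v\<close>, so these sets have a common point. \<open>S\<close> is separate from
  \<open>R\<close> so that it can be either \<open>R\<close> or its converse.\<close>

lemma common_successor:
  assumes S: "stone_closed_rel S" and R: "stone_closed_rel R" and \<phi>: "closed_fm \<phi>" "positive_fm \<phi>"
    and F: "\<And>p. F p \<subseteq> Ult" and x: "x \<in> Ult"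
    and succ: "\<And>v. F \<le> stone_val v \<Longrightarrow> \<exists>y\<in>eval Ult R (stone_val v) \<phi>. S x y"
  shows "\<exists>y\<in>Ult. S x y \<and> (\<forall>v. F \<le> stone_val v \<longrightarrow> y \<in> eval Ult R (stone_val v) \<phi>)"
proof -
  \<comment> \<open>The successors of \<open>x\<close> are written as the image of the closed set
    \<open>{x}\<close>, to match \<open>stone_closed_image\<close>.\<close>
  define C where "C v = {y \<in> Ult. \<exists>z\<in>{x}. S z y} \<inter> eval Ult R (stone_val v) \<phi>" for v
  let ?\<C> = "C ` {v. F \<le> stone_val v}"
  have top: "F \<le> stone_val top" using F by (rule le_stone_val_top)
  have "\<Inter>?\<C> \<noteq> {}"
  proof (rule directed_stone_closed_Inter_nonempty)
    show "?\<C> \<noteq> {}" using top by auto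
  next
    fix D assume "D \<in> ?\<C>"
    then obtain v where v: "F \<le> stone_val v" and D: "D = C v" by blast
    have "stone_closed (C v)" unfolding C_def
      by (intro stone_closed_Int stone_closed_image stone_closed_singleton stone_closed_eval_closed_fm S R \<phi> x)
    moreover have "C v \<noteq> {}"
      using succ[OF v] eval_subset[of "stone_val v" Ult R \<phi>] stone_subset_Ult by (auto simp: C_def)
    ultimately show "stone_closed D \<and> D \<noteq> {}" by (simp add: D)
  next
    fix D E assume "D \<in> ?\<C>" "E \<in> ?\<C>"
    then obtain u v where "F \<le> stone_val u" "F \<le> stone_val v" and DE: "D = C u" "E = C v" by blast
    then have "F \<le> stone_val (inf u v)" by (simp only: le_stone_val_inf_iff)
    moreover have "C (inf u v) \<subseteq> D \<inter> E"
      using eval_stone_val_inf[OF \<phi>(2), of Ult R u v] unfolding C_def DE by blast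
    ultimately show "\<exists>G\<in>?\<C>. G \<subseteq> D \<inter> E" by blast
  qed
  then obtain y where y: "\<And>v. F \<le> stone_val v \<Longrightarrow> y \<in> C v" by blast
  from y[OF top] have "y \<in> Ult" "S x y" by (simp_all add: C_def)
  moreover have "\<forall>v. F \<le> stone_val v \<longrightarrow> y \<in> eval Ult R (stone_val v) \<phi>" using y by (simp add: C_def)
  ultimately show ?thesis by blast
qed

text \<open>If \<phi> failed under \<open>u\<close> and \<psi> under \<open>v\<close>, both would
  fail under \<open>inf u v\<close> by monotonicity.\<close>

lemma esakia_disjunction:
  assumes pos: "positive_fm \<phi>" "positive_fm \<psi>"
    and x: "\<And>v. F \<le> stone_val v \<Longrightarrow> x \<in> eval Ult R (stone_val v) (Or \<phi> \<psi>)"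
  shows "(\<forall>v. F \<le> stone_val v \<longrightarrow> x \<in> eval Ult R (stone_val v) \<phi>) \<or>
    (\<forall>v. F \<le> stone_val v \<longrightarrow> x \<in> eval Ult R (stone_val v) \<psi>)"
proof (rule ccontr)
  assume "\<not> ?thesis"
  then obtain u v where uv: "F \<le> stone_val u" "x \<notin> eval Ult R (stone_val u) \<phi>"
    "F \<le> stone_val v" "x \<notin> eval Ult R (stone_val v) \<psi>" by blast
  then have "x \<in> eval Ult R (stone_val (inf u v)) (Or \<phi> \<psi>)" by (intro x) (simp only: le_stone_val_inf_iff)
  then show False
    using uv eval_stone_val_inf[OF pos(1), of Ult R u v] eval_stone_val_inf[OF pos(2), of Ult R u v]
    unfolding eval.simps by blast
qed

text \<open>Induction on the closed formula: variables use closedness of \<open>F\<close>,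
  disjunctions use directedness, and the two diamonds use compactness.\<close>

lemma esakia_closed_positive:
  assumes "closed_fm \<phi>" "positive_fm \<phi>" and R: "stone_closed_rel R" and F: "\<And>p. stone_closed (F p)"
    and "x \<in> Ult" "\<And>v. F \<le> stone_val v \<Longrightarrow> x \<in> eval Ult R (stone_val v) \<phi>"
  shows "x \<in> eval Ult R F \<phi>"
  using assms(1,2,5,6)
proof (induction arbitrary: x)
  case 1 then show ?case by simp
next
  case 2
  \<comment> \<open>At least one clopen valuation lies above \<open>F\<close>, so the premise about
    \<open>Falsum\<close> is not vacuous.\<close>
  have "F \<le> stone_val top" using F by (intro le_stone_val_top) (simp add: stone_closed_def)
  then show ?case using 2 by fastforce
next
  case (3 p)
  have "a \<in> x" if a: "F p \<subseteq> stone a" for a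
  proof -
    \<comment> \<open>Only \<open>p\<close> is tested against \<open>a\<close>; the default
      \<open>top\<close> bounds every other variable.\<close>
    have "F \<le> stone_val (top(p := a))"
      using a F by (simp add: le_fun_def stone_top stone_closed_def)
    then show ?thesis using 3(3) by (fastforce simp: stone_def)
  qed
  then show ?case using F[of p] 3 by (simp add: stone_closed_def)
next
  case (4 p) then show ?case by (auto elim: positive_fm.cases)
next
  case (5 \<phi> \<psi>)
  then show ?case using esakia_disjunction[of \<phi> \<psi> F x R] positive_fm_inversions(1)
    by (metis UnI1 UnI2 eval.simps(4))
next
  case (6 \<phi> \<psi>) then show ?case using positive_fm_inversions(2)[of \<phi> \<psi>] by simp
next
  case (7 \<phi>)
  have pos: "positive_fm \<phi>" using 7 positive_fm_inversions by blast
  have "\<exists>y\<in>Ult. R x y \<and> (\<forall>v. F \<le> stone_val v \<longrightarrow> y \<in> eval Ult R (stone_val v) \<phi>)"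
    using F 7 pos by (intro common_successor[OF R R]) (auto simp: stone_closed_def)
  then show ?case using 7 pos by auto
next
  case (8 \<phi>)
  have pos: "positive_fm \<phi>" using 8 positive_fm_inversions by blast
  have "\<exists>y\<in>Ult. R\<inverse>\<inverse> x y \<and> (\<forall>v. F \<le> stone_val v \<longrightarrow> y \<in> eval Ult R (stone_val v) \<phi>)"
    using F 8 pos by (intro common_successor[OF stone_closed_rel_conversep[OF R] R]) (auto simp: stone_closed_def)
  then show ?case using 8 pos by auto
qed

lemma eval_Box: "x \<in> X \<Longrightarrow> x \<in> eval X R V (Box \<phi>) \<longleftrightarrow> (\<forall>y\<in>X. R x y \<longrightarrow> y \<in> eval X R V \<phi>)"
  and eval_BBox: "x \<in> X \<Longrightarrow> x \<in> eval X R V (BBox \<phi>) \<longleftrightarrow> (\<forall>y\<in>X. R y x \<longrightarrow> y \<in> eval X R V \<phi>)"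
  by auto

text \<open>The outer boxes cost no compactness, since a universal quantifier over successors
  commutes with the one over clopen valuations.\<close>

lemma esakia_s_positive:
  assumes "s_positive \<phi>" and R: "stone_closed_rel R" and F: "\<And>p. stone_closed (F p)"
    and "x \<in> Ult" "\<And>v. F \<le> stone_val v \<Longrightarrow> x \<in> eval Ult R (stone_val v) \<phi>"
  shows "x \<in> eval Ult R F \<phi>"
  using assms(1,4,5)
proof (induction arbitrary: x)
  case (1 \<phi>) then show ?case using esakia_closed_positive R F by blast
next
  case (2 \<phi> \<psi>)
  then show ?case using esakia_disjunction[of \<phi> \<psi> F x R] s_positive_imp_positive
    by (metis UnI1 UnI2 eval.simps(4))
next
  case (3 \<phi> \<psi>) then show ?case by simp
next
  case (4 \<phi>) then show ?case by (metis eval_Box)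
next
  case (5 \<phi>) then show ?case by (metis eval_BBox)
qed

section \<open>Duality between negative and positive formulas\<close>

text \<open>The witness is the De Morgan dual, chosen independently of frame and valuation.
  Valuations must stay inside \<open>X\<close> so that a doubly complemented variable returns to its
  value.\<close>

lemma open_negative_complement:
  assumes "open_fm \<phi>" "negative_fm \<phi>"
  shows "\<exists>\<phi>'. closed_fm \<phi>' \<and> positive_fm \<phi>' \<and>
    (\<forall>X R V. (\<forall>p. V p \<subseteq> X) \<longrightarrow> eval X R V \<phi>' = X - (eval X R V \<phi> :: 'w set))"
  using assms
proof induction
  case 1 show ?case by (rule exI[of _ Falsum]) (auto intro: closed_fm.intros positive_fm.intros)
next
  case 2 show ?case by (rule exI[of _ Verum]) (auto intro: closed_fm.intros positive_fm.intros)
next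
  case (3 p) then show ?case by (simp add: negative_fm_inversions)
next
  case (4 p) show ?case by (rule exI[of _ "Var p"]) (auto intro: closed_fm.intros positive_fm.intros)
next
  case (5 \<phi> \<psi>)
  then obtain \<phi>' \<psi>' where "closed_fm \<phi>'" "positive_fm \<phi>'" "closed_fm \<psi>'" "positive_fm \<psi>'"
    "\<forall>X R V. (\<forall>p. V p \<subseteq> X) \<longrightarrow> eval X R V \<phi>' = X - (eval X R V \<phi> :: 'w set)"
    "\<forall>X R V. (\<forall>p. V p \<subseteq> X) \<longrightarrow> eval X R V \<psi>' = X - (eval X R V \<psi> :: 'w set)"
    using negative_fm_inversions by metis
  then show ?case
    by (intro exI[of _ "And \<phi>' \<psi>'"]) (auto intro: closed_fm.intros positive_fm.intros)
next
  case (6 \<phi> \<psi>)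
  then obtain \<phi>' \<psi>' where "closed_fm \<phi>'" "positive_fm \<phi>'" "closed_fm \<psi>'" "positive_fm \<psi>'"
    "\<forall>X R V. (\<forall>p. V p \<subseteq> X) \<longrightarrow> eval X R V \<phi>' = X - (eval X R V \<phi> :: 'w set)"
    "\<forall>X R V. (\<forall>p. V p \<subseteq> X) \<longrightarrow> eval X R V \<psi>' = X - (eval X R V \<psi> :: 'w set)"
    using negative_fm_inversions by metis
  then show ?case
    by (intro exI[of _ "Or \<phi>' \<psi>'"]) (auto intro: closed_fm.intros positive_fm.intros)
next
  case (7 \<phi>)
  then obtain \<phi>' where "closed_fm \<phi>'" "positive_fm \<phi>'"
    "\<forall>X R V. (\<forall>p. V p \<subseteq> X) \<longrightarrow> eval X R V \<phi>' = X - (eval X R V \<phi> :: 'w set)"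
    using negative_fm_inversions by metis
  then show ?case
    by (intro exI[of _ "Dia \<phi>'"]) (auto intro: closed_fm.intros positive_fm.intros)
next
  case (8 \<phi>)
  then obtain \<phi>' where "closed_fm \<phi>'" "positive_fm \<phi>'"
    "\<forall>X R V. (\<forall>p. V p \<subseteq> X) \<longrightarrow> eval X R V \<phi>' = X - (eval X R V \<phi> :: 'w set)"
    using negative_fm_inversions by metis
  then show ?case
    by (intro exI[of _ "BDia \<phi>'"]) (auto intro: closed_fm.intros positive_fm.intros)
qed

lemma s_negative_complement:
  assumes "s_negative \<phi>"
  shows "\<exists>\<phi>'. s_positive \<phi>' \<and>
    (\<forall>X R V. (\<forall>p. V p \<subseteq> X) \<longrightarrow> eval X R V \<phi>' = X - (eval X R V \<phi> :: 'w set))"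
  using assms
proof induction
  case (1 \<phi>)
  then show ?case using open_negative_complement s_positive.intros(1) by metis
next
  case (2 \<phi> \<psi>)
  then obtain \<phi>' \<psi>' where "s_positive \<phi>'" "s_positive \<psi>'"
    "\<forall>X R V. (\<forall>p. V p \<subseteq> X) \<longrightarrow> eval X R V \<phi>' = X - (eval X R V \<phi> :: 'w set)"
    "\<forall>X R V. (\<forall>p. V p \<subseteq> X) \<longrightarrow> eval X R V \<psi>' = X - (eval X R V \<psi> :: 'w set)" by metis
  then show ?case by (intro exI[of _ "And \<phi>' \<psi>'"]) (auto intro: s_positive.intros)
next
  case (3 \<phi> \<psi>)
  then obtain \<phi>' \<psi>' where "s_positive \<phi>'" "s_positive \<psi>'"
    "\<forall>X R V. (\<forall>p. V p \<subseteq> X) \<longrightarrow> eval X R V \<phi>' = X - (eval X R V \<phi> :: 'w set)"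
    "\<forall>X R V. (\<forall>p. V p \<subseteq> X) \<longrightarrow> eval X R V \<psi>' = X - (eval X R V \<psi> :: 'w set)" by metis
  then show ?case by (intro exI[of _ "Or \<phi>' \<psi>'"]) (auto intro: s_positive.intros)
next
  case (4 \<phi>)
  then obtain \<phi>' where \<phi>': "s_positive \<phi>'"
    "\<forall>X R V. (\<forall>p. V p \<subseteq> X) \<longrightarrow> eval X R V \<phi>' = X - (eval X R V \<phi> :: 'w set)" by metis
  have "eval X R V (Box \<phi>') = X - eval X R V (Dia \<phi>)" if "\<forall>p. V p \<subseteq> X" for X R and V :: "nat \<Rightarrow> 'w set"
    using that \<phi>'(2) eval_subset[of V X R \<phi>] by auto
  then show ?case using \<phi>'(1) s_positive.intros(4) by (intro exI[of _ "Box \<phi>'"]) simp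
next
  case (5 \<phi>)
  then obtain \<phi>' where \<phi>': "s_positive \<phi>'"
    "\<forall>X R V. (\<forall>p. V p \<subseteq> X) \<longrightarrow> eval X R V \<phi>' = X - (eval X R V \<phi> :: 'w set)" by metis
  have "eval X R V (BBox \<phi>') = X - eval X R V (BDia \<phi>)" if "\<forall>p. V p \<subseteq> X" for X R and V :: "nat \<Rightarrow> 'w set"
    using that \<phi>'(2) eval_subset[of V X R \<phi>] by auto
  then show ?case using \<phi>'(1) s_positive.intros(5) by (intro exI[of _ "BBox \<phi>'"]) simp
qed

text \<open>The contrapositive of \<open>esakia_s_positive\<close>, applied to the s-positive
  complement.\<close>

lemma esakia_s_negative:
  assumes \<phi>: "s_negative \<phi>" and R: "stone_closed_rel R" and F: "\<And>p. stone_closed (F p)"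
    and x: "x \<in> eval Ult R F \<phi>"
  shows "\<exists>v. F \<le> stone_val v \<and> x \<in> eval Ult R (stone_val v) \<phi>"
proof -
  have FU: "F p \<subseteq> Ult" for p using F by (simp add: stone_closed_def)
  obtain \<phi>' where \<phi>': "s_positive \<phi>'"
    "\<And>V. (\<forall>p. V p \<subseteq> Ult) \<Longrightarrow> eval Ult R V \<phi>' = Ult - eval Ult R V \<phi>"
    using s_negative_complement[OF \<phi>] by metis
  have "x \<in> Ult" using x eval_subset[of F Ult R \<phi>] FU by blast
  moreover have "x \<notin> eval Ult R F \<phi>'" using \<phi>' FU x by simp
  ultimately obtain v where v: "F \<le> stone_val v" "x \<notin> eval Ult R (stone_val v) \<phi>'"
    using esakia_s_positive \<phi>' R F by blast
  then show ?thesis using \<phi>'(2)[of "stone_val v"] \<open>x \<in> Ult\<close> stone_subset_Ult by blast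
qed


section \<open>From clopen to arbitrary valuations\<close>

text \<open>\<open>Box\<close> is right adjoint to the image under \<open>R\<close>, and \<open>BBox\<close> to the preimage.\<close>

lemma closed_adjoint_Box:
  assumes "stone_closed_rel R" "stone_closed C"
  shows "\<exists>D. stone_closed D \<and> (\<forall>V. C \<subseteq> eval Ult R V (Box \<phi>) \<longleftrightarrow> D \<subseteq> eval Ult R V \<phi>)"
  using stone_closed_image[OF assms] assms(2)
  by (intro exI[of _ "{y \<in> Ult. \<exists>x\<in>C. R x y}"]) (auto simp: stone_closed_def)

lemma closed_adjoint_BBox:
  assumes "stone_closed_rel R" "stone_closed C"
  shows "\<exists>D. stone_closed D \<and> (\<forall>V. C \<subseteq> eval Ult R V (BBox \<phi>) \<longleftrightarrow> D \<subseteq> eval Ult R V \<phi>)"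
  using stone_closed_image[OF stone_closed_rel_conversep[OF assms(1)] assms(2)] assms(2)
  by (intro exI[of _ "{y \<in> Ult. \<exists>x\<in>C. R y x}"]) (auto simp: stone_closed_def)

lemma closed_adjoint_power:
  assumes R: "stone_closed_rel R" and "stone_closed C"
  shows "\<exists>D. stone_closed D \<and> (\<forall>V. C \<subseteq> eval Ult R V (((\<lambda>\<psi>. Box \<psi>) ^^ m) \<phi>) \<longleftrightarrow> D \<subseteq> eval Ult R V \<phi>)"
    and "\<exists>D. stone_closed D \<and> (\<forall>V. C \<subseteq> eval Ult R V (((\<lambda>\<psi>. BBox \<psi>) ^^ m) \<phi>) \<longleftrightarrow> D \<subseteq> eval Ult R V \<phi>)"
proof -
  show "\<exists>D. stone_closed D \<and> (\<forall>V. C \<subseteq> eval Ult R V (((\<lambda>\<psi>. Box \<psi>) ^^ m) \<phi>) \<longleftrightarrow> D \<subseteq> eval Ult R V \<phi>)"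
    using assms(2)
  proof (induction m arbitrary: C)
    case (Suc m)
    then show ?case
      using closed_adjoint_Box[OF R Suc.prems, of "((\<lambda>\<psi>. Box \<psi>) ^^ m) \<phi>"] by (simp del: eval.simps) metis
  qed auto
  show "\<exists>D. stone_closed D \<and> (\<forall>V. C \<subseteq> eval Ult R V (((\<lambda>\<psi>. BBox \<psi>) ^^ m) \<phi>) \<longleftrightarrow> D \<subseteq> eval Ult R V \<phi>)"
    using assms(2)
  proof (induction m arbitrary: C)
    case (Suc m)
    then show ?case
      using closed_adjoint_BBox[OF R Suc.prems, of "((\<lambda>\<psi>. BBox \<psi>) ^^ m) \<phi>"] by (simp del: eval.simps) metis
  qed auto
qed

text \<open>Adjoints compose, so a whole word of boxes is absorbed into one closed set
  \<open>D\<close>. As \<open>D\<close> is chosen before \<open>V\<close>, it serves as the least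
  value for a variable under that word.\<close>

lemma closed_adjoint_boxes:
  assumes R: "stone_closed_rel R"
  shows "stone_closed C \<Longrightarrow> \<exists>D. stone_closed D \<and> (\<forall>V. C \<subseteq> eval Ult R V (boxes \<mu> \<phi>) \<longleftrightarrow> D \<subseteq> eval Ult R V \<phi>)"
    and "stone_closed C \<Longrightarrow> \<exists>D. stone_closed D \<and> (\<forall>V. C \<subseteq> eval Ult R V (bboxes \<mu> \<phi>) \<longleftrightarrow> D \<subseteq> eval Ult R V \<phi>)"
proof (induction \<mu> \<phi> and \<mu> \<phi> arbitrary: C and C rule: boxes_bboxes.induct)
  case (2 m \<mu> \<phi>)
  then show ?case using closed_adjoint_power(1)[OF R 2(2), of m "bboxes \<mu> \<phi>"] by (simp del: eval.simps) metis
next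
  case (4 m \<mu> \<phi>)
  then show ?case using closed_adjoint_power(2)[OF R 4(2), of m "boxes \<mu> \<phi>"] by (simp del: eval.simps) metis
qed auto

section \<open>Persistence of the antecedent near a closed valuation\<close>

lemma strongly_positive_closed_minimal_valuation:
  assumes "strongly_positive \<phi>" and R: "stone_closed_rel R" and x: "x \<in> eval Ult R V \<phi>" "x \<in> Ult"
  shows "\<exists>M. (\<forall>p. stone_closed (M p)) \<and> M \<le> V \<and> (\<forall>W. M \<le> W \<longrightarrow> x \<in> eval Ult R W \<phi>)"
  using assms(1) x(1)
proof induction
  case (1 \<mu> p)
  \<comment> \<open>\<open>D\<close> consists of the points reached from \<open>x\<close> along the
    box prefix; it is the minimal value of \<open>p\<close>, and all other variables may be
    empty.\<close>
  obtain D where D: "stone_closed D" "\<And>V. {x} \<subseteq> eval Ult R V (boxes \<mu> (Var p)) \<longleftrightarrow> D \<subseteq> V p"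
    using closed_adjoint_boxes(1)[OF R stone_closed_singleton[OF x(2)], of \<mu> "Var p"] by auto
  then show ?case using 1
    by (intro exI[of _ "(\<lambda>_. {})(p := D)"]) (auto simp: stone_closed_empty le_fun_def)
next
  case (2 \<phi> \<psi>)
  then obtain M N where MN: "\<forall>p. stone_closed (M p)" "M \<le> V" "\<forall>W. M \<le> W \<longrightarrow> x \<in> eval Ult R W \<phi>"
    "\<forall>p. stone_closed (N p)" "N \<le> V" "\<forall>W. N \<le> W \<longrightarrow> x \<in> eval Ult R W \<psi>" by auto
  show ?case
  proof (intro exI[of _ "sup M N"] conjI allI impI)
    show "stone_closed (sup M N p)" for p using MN by (simp add: stone_closed_Un)
    show "sup M N \<le> V" using MN by (intro le_supI)
    fix W assume "sup M N \<le> W"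
    then have "M \<le> W" "N \<le> W" by (simp_all only: le_sup_iff)
    then show "x \<in> eval Ult R W (And \<phi> \<psi>)" using MN by simp
  qed
qed

text \<open>Quantifying over all closed \<open>F\<close> between \<open>M\<close> and \<open>V\<close> lets the claim pass through conjunctions:
  there \<open>M\<close> grows, which the s-negative parts must survive.\<close>

lemma s_untied_clopen_neighbourhood:
  assumes "s_untied \<phi>" and R: "stone_closed_rel R" and V: "\<And>p. V p \<subseteq> Ult"
    and "x \<in> eval Ult R V \<phi>"
  shows "\<exists>M. (\<forall>p. stone_closed (M p)) \<and> M \<le> V \<and>
    (\<forall>F. (\<forall>p. stone_closed (F p)) \<longrightarrow> M \<le> F \<longrightarrow> F \<le> V \<longrightarrow>
      (\<exists>v. F \<le> stone_val v \<and> (\<forall>W. F \<le> W \<longrightarrow> W \<le> stone_val v \<longrightarrow> x \<in> eval Ult R W \<phi>)))"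
  using assms(1,4)
proof (induction arbitrary: x)
  case (1 \<phi>)
  have "x \<in> Ult" using 1 V eval_subset by blast
  then obtain M where M: "\<forall>p. stone_closed (M p)" "M \<le> V" "\<forall>W. M \<le> W \<longrightarrow> x \<in> eval Ult R W \<phi>"
    using strongly_positive_closed_minimal_valuation[OF 1(1) R 1(2)] by blast
  \<comment> \<open>Truth holds for every \<open>W\<close> above \<open>M\<close>, so the trivial
    upper bound \<open>top\<close> suffices.\<close>
  moreover have "F \<le> stone_val top" if "F \<le> V" for F
    using that le_stone_val_top[OF V] by (rule order_trans)
  ultimately show ?case by (meson order_trans)
next
  case (2 \<phi>)
  have "\<exists>v. F \<le> stone_val v \<and> (\<forall>W. F \<le> W \<longrightarrow> W \<le> stone_val v \<longrightarrow> x \<in> eval Ult R W \<phi>)"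
    if F: "\<forall>p. stone_closed (F p)" "F \<le> V" for F
  proof -
    note neg = s_negative_imp_negative[OF 2(1)]
    \<comment> \<open>Truth descends from \<open>V\<close> to \<open>F\<close>; Esakia then lifts it
      to a clopen \<open>v\<close> above \<open>F\<close>, and everything below \<open>v\<close>
      inherits it. No lower bound is needed, whence the empty \<open>M\<close>.\<close>
    have "x \<in> eval Ult R F \<phi>" using eval_antimono[OF neg F(2)] 2(2) by blast
    then obtain v where "F \<le> stone_val v" "x \<in> eval Ult R (stone_val v) \<phi>"
      using esakia_s_negative[OF 2(1) R] F(1) by blast
    then show ?thesis using eval_antimono[OF neg] by blast
  qed
  then show ?case by (intro exI[of _ "\<lambda>_. {}"]) (auto simp: stone_closed_empty le_fun_def)
next
  case (3 \<phi> \<psi>)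
  obtain M where M: "\<forall>p. stone_closed (M p)" "M \<le> V" "\<And>F. \<forall>p. stone_closed (F p) \<Longrightarrow> M \<le> F \<Longrightarrow> F \<le> V \<Longrightarrow>
      \<exists>v. F \<le> stone_val v \<and> (\<forall>W. F \<le> W \<longrightarrow> W \<le> stone_val v \<longrightarrow> x \<in> eval Ult R W \<phi>)"
    using 3 by (metis IntD1 eval.simps(5))
  obtain N where N: "\<forall>p. stone_closed (N p)" "N \<le> V" "\<And>F. \<forall>p. stone_closed (F p) \<Longrightarrow> N \<le> F \<Longrightarrow> F \<le> V \<Longrightarrow>
      \<exists>v. F \<le> stone_val v \<and> (\<forall>W. F \<le> W \<longrightarrow> W \<le> stone_val v \<longrightarrow> x \<in> eval Ult R W \<psi>)"
    using 3 by (metis IntD2 eval.simps(5))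
  show ?case
  proof (intro exI[of _ "sup M N"] conjI allI impI)
    show "stone_closed (sup M N p)" for p using M(1) N(1) by (simp add: stone_closed_Un)
    show "sup M N \<le> V" using M(2) N(2) by (rule le_supI)
    fix F assume F: "\<forall>p. stone_closed (F p)" "sup M N \<le> F" "F \<le> V"
    have MF: "M \<le> F" and NF: "N \<le> F" using F(2) by (simp_all only: le_sup_iff)
    obtain u where u: "F \<le> stone_val u" "\<forall>W. F \<le> W \<longrightarrow> W \<le> stone_val u \<longrightarrow> x \<in> eval Ult R W \<phi>"
      using M(3)[OF F(1) MF F(3)] by metis
    obtain v where v: "F \<le> stone_val v" "\<forall>W. F \<le> W \<longrightarrow> W \<le> stone_val v \<longrightarrow> x \<in> eval Ult R W \<psi>"
      using N(3)[OF F(1) NF F(3)] by metis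
    show "\<exists>v. F \<le> stone_val v \<and> (\<forall>W. F \<le> W \<longrightarrow> W \<le> stone_val v \<longrightarrow> x \<in> eval Ult R W (And \<phi> \<psi>))"
    \<comment> \<open>Lower bounds are joined and upper bounds met, so both conjuncts hold
      throughout the smaller interval.\<close>
    proof (intro exI[of _ "inf u v"] conjI allI impI)
      show "F \<le> stone_val (inf u v)" unfolding le_stone_val_inf_iff using u v by blast
      fix W assume "F \<le> W" "W \<le> stone_val (inf u v)"
      then show "x \<in> eval Ult R W (And \<phi> \<psi>)" unfolding le_stone_val_inf_iff using u v by simp
    qed
  qed
next
  case (4 \<phi>)
  \<comment> \<open>The witness found under \<open>V\<close> is kept for all valuations, since
    \<open>R x y\<close> does not depend on them; the bounds for \<open>y\<close> therefore serve
    \<open>x\<close>.\<close>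
  then obtain y where y: "y \<in> eval Ult R V \<phi>" "R x y" and x: "x \<in> Ult" by auto
  have dia: "x \<in> eval Ult R W (Dia \<phi>)" if "y \<in> eval Ult R W \<phi>" for W using that y x by auto
  show ?case using 4(2)[OF y(1)]
    by (elim ex_forward conj_forward all_forward imp_forward) (assumption | erule dia)+
next
  case (5 \<phi>)
  then obtain y where y: "y \<in> eval Ult R V \<phi>" "R y x" and x: "x \<in> Ult" by auto
  have dia: "x \<in> eval Ult R W (BDia \<phi>)" if "y \<in> eval Ult R W \<phi>" for W using that y x by auto
  show ?case using 5(2)[OF y(1)]
    by (elim ex_forward conj_forward all_forward imp_forward) (assumption | erule dia)+
qed

section \<open>Local persistence and the correspondence\<close>

text \<open>Stated at single points because validity of a boxed formula at \<open>x\<close> concerns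
  only the neighbours of \<open>x\<close>; global persistence would not pass through the box
  prefix.\<close>

definition locally_clopen_persistent :: "('a::boolean_algebra set \<Rightarrow> 'a set \<Rightarrow> bool) \<Rightarrow> fm \<Rightarrow> bool" where
  "locally_clopen_persistent R \<phi> \<longleftrightarrow> (\<forall>x\<in>Ult. (\<forall>v. x \<in> eval Ult R (stone_val v) \<phi>) \<longrightarrow>
    (\<forall>V. (\<forall>p. V p \<subseteq> Ult) \<longrightarrow> x \<in> eval Ult R V \<phi>))"

lemma locally_clopen_persistent_Imp:
  assumes \<phi>: "s_untied \<phi>" and \<psi>: "s_positive \<psi>" and R: "stone_closed_rel R"
  shows "locally_clopen_persistent R (Imp \<phi> \<psi>)"
  unfolding locally_clopen_persistent_def
proof (intro ballI allI impI)
  fix x :: "'a set" and V :: "nat \<Rightarrow> 'a set set"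
  assume x: "x \<in> Ult" and valid: "\<forall>v. x \<in> eval Ult R (stone_val v) (Imp \<phi> \<psi>)" and V: "\<forall>p. V p \<subseteq> Ult"
  have "x \<in> eval Ult R V \<psi>" if ant: "x \<in> eval Ult R V \<phi>"
  proof -
    obtain M where M: "\<forall>p. stone_closed (M p)" "M \<le> V" "\<And>F. \<forall>p. stone_closed (F p) \<Longrightarrow> M \<le> F \<Longrightarrow> F \<le> V \<Longrightarrow>
      \<exists>v. F \<le> stone_val v \<and> (\<forall>W. F \<le> W \<longrightarrow> W \<le> stone_val v \<longrightarrow> x \<in> eval Ult R W \<phi>)"
      using s_untied_clopen_neighbourhood[OF \<phi> R V[rule_format] ant] by metis
    \<comment> \<open>The intermediate closed valuation is taken to be \<open>M\<close>
      itself.\<close>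
    obtain u where u: "M \<le> stone_val u" "\<And>W. M \<le> W \<Longrightarrow> W \<le> stone_val u \<Longrightarrow> x \<in> eval Ult R W \<phi>"
      using M(3)[OF M(1) order_refl M(2)] by metis
    note pos = s_positive_imp_positive[OF \<psi>]
    have "x \<in> eval Ult R (stone_val v) \<psi>" if v: "M \<le> stone_val v" for v
    proof -
      \<comment> \<open>An arbitrary \<open>v\<close> above \<open>M\<close> may make the antecedent
        false, but \<open>inf u v\<close> lies between \<open>M\<close> and \<open>u\<close>. The
        consequent obtained there rises to \<open>v\<close> by monotonicity.\<close>
      have "x \<in> eval Ult R (stone_val (inf u v)) \<phi>"
      proof (rule u(2))
        show "M \<le> stone_val (inf u v)" unfolding le_stone_val_inf_iff using u(1) v ..
        show "stone_val (inf u v) \<le> stone_val u" by (simp add: le_fun_def stone_inf)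
      qed
      then have "x \<in> eval Ult R (stone_val (inf u v)) \<psi>"
        using valid[rule_format, of "inf u v"] unfolding eval.simps by blast
      then show ?thesis using eval_stone_val_inf[OF pos] by blast
    qed
    then have "x \<in> eval Ult R M \<psi>" using esakia_s_positive[OF \<psi> R] M(1) x by blast
    then show ?thesis using eval_mono[OF pos M(2)] by blast
  qed
  then show "x \<in> eval Ult R V (Imp \<phi> \<psi>)" using x by auto
qed

lemma locally_clopen_persistent_Box:
  "locally_clopen_persistent R \<phi> \<Longrightarrow> locally_clopen_persistent R (Box \<phi>)"
  unfolding locally_clopen_persistent_def by (simp add: eval_Box del: eval.simps)

lemma locally_clopen_persistent_BBox:
  "locally_clopen_persistent R \<phi> \<Longrightarrow> locally_clopen_persistent R (BBox \<phi>)"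
  unfolding locally_clopen_persistent_def by (simp add: eval_BBox del: eval.simps)

lemma locally_clopen_persistent_power:
  "locally_clopen_persistent R \<phi> \<Longrightarrow> locally_clopen_persistent R (((\<lambda>\<psi>. Box \<psi>) ^^ m) \<phi>)"
  "locally_clopen_persistent R \<phi> \<Longrightarrow> locally_clopen_persistent R (((\<lambda>\<psi>. BBox \<psi>) ^^ m) \<phi>)"
  by (induction m) (simp_all add: locally_clopen_persistent_Box locally_clopen_persistent_BBox)

lemma locally_clopen_persistent_boxes:
  "locally_clopen_persistent R \<phi> \<Longrightarrow> locally_clopen_persistent R (boxes \<mu> \<phi>)"
  "locally_clopen_persistent R \<phi> \<Longrightarrow> locally_clopen_persistent R (bboxes \<mu> \<phi>)"
  by (induction \<mu> \<phi> and \<mu> \<phi> rule: boxes_bboxes.induct) (simp_all add: locally_clopen_persistent_power)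

theorem theorem3p5:
  fixes prec :: "'a::boolean_algebra \<Rightarrow> 'a \<Rightarrow> bool"
    and \<phi> :: fm
  assumes "s_sahlqvist \<phi>"
    and "subordination_algebra prec"
  shows "validates prec \<phi> \<longleftrightarrow> models Ult (dual_rel prec) (sahlqvist_correspondent \<phi>)"
proof -
  have persistent: "locally_clopen_persistent (dual_rel prec) \<phi>"
    using assms(1) locally_clopen_persistent_boxes(1) locally_clopen_persistent_Imp
      stone_closed_rel_dual_rel unfolding s_sahlqvist_def by blast
  have "validates prec \<phi> \<longleftrightarrow> (\<forall>V. (\<forall>p. V p \<subseteq> Ult) \<longrightarrow> eval Ult (dual_rel prec) V \<phi> = Ult)"
  proof
    assume L: "validates prec \<phi>"
    show "\<forall>V. (\<forall>p. V p \<subseteq> Ult) \<longrightarrow> eval Ult (dual_rel prec) V \<phi> = Ult"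
    proof (intro allI impI subset_antisym)
      fix V :: "nat \<Rightarrow> 'a set set" assume V: "\<forall>p. V p \<subseteq> Ult"
      then show "eval Ult (dual_rel prec) V \<phi> \<subseteq> Ult" by (simp add: eval_subset)
      show "Ult \<subseteq> eval Ult (dual_rel prec) V \<phi>"
        using persistent L V unfolding locally_clopen_persistent_def validates_def by blast
    qed
  \<comment> \<open>Conversely, clopen valuations are among the arbitrary ones.\<close>
  qed (simp add: validates_def stone_subset_Ult)
  then show ?thesis using classical_correspondence[OF assms(1)] by metis
qed

end
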